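(* Let a Cauchy problem $$w'(z)=F\circ\eta(z,w(z)),\qquad w(z_0)=w_0,$$ be given, with data $(\mathcal{B},\Delta,p,\Sigma,F,X_0,(z_0,w_0),\eta)$ as described in the context (in particular $(\Delta,p)$ is a proper Riemann domain over $\mathbb{C}^2\setminus\mathcal{B}$), and let $w$ be its initial solution. Suppose that the singularities of the differential equation, i.e. $\mathcal{B}\cup p(\Sigma)$, are contained in a complex-analytic curve $\mathcal{S}\subset\mathbb{C}^2$. Let $\gamma:[0,1]\to\mathbb{C}$ be a (continuous) arc with $\gamma(0)=z_0$ such that the complex line $\{(z,w)\in\mathbb{C}^2: z=\gamma(1)\}$ is not contained in $\mathcal{S}$. Suppose that a regular analytic continuation $(R,\pi,j,\omega)$ of the initial solution $w$ can be obtained along $\gamma|_{[0,1)}$, with $\omega:R\to\mathbb{C}$, and let $\widetilde\gamma:[0,1)\to R$ be the lifted arc of $\gamma|_{[0,1)}$ with respect to $\pi$. Then the limit $$\lim_{t\to 1}\omega\circ\widetilde\gamma(t)$$ exists, finite or infinite (that is, it exists in $\mathbb{P}^1=\mathbb{C}\cup\{\infty\}$).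
   Context: **Riemann domains.** A Riemann domain over a region $\mathcal{U}\subset\mathbb{C}^n$ is a complex manifold $\Delta$ together with an everywhere maximum-rank holomorphic surjective mapping $p:\Delta\to\mathcal{U}$ (with $\dim\Delta=n$, so $p$ is a local biholomorphism). It is proper if $p$ is a proper map. For $n=1$ it is a Riemann surface. A complex-analytic curve in $\mathbb{C}^2$ is the zero set of one (not identically zero) holomorphic function on $\mathbb{C}^2$. **Regular analytic continuation.** Let $M$ be a complex manifold, $U\subset\mathbb{C}^n$ open and $f:U\to M$ holomorphic. A regular analytic continuation of $(U,f)$ is a quadruple $(S,\pi,j,G)$ such that: (1) $S$ is a connected Riemann domain over a region in $\mathbb{C}^n$; (2) $\pi:S\to\mathbb{C}^n$ is an everywhere nondegenerate holomorphic mapping with $U\subset\pi(S)$; (3) $j:U\to S$ is a holomorphic immersion with $\pi\circ j=\mathrm{id}|_U$; (4) $G:S\to M$ is holomorphic with $G\circ j=f$. Let $\gamma:I\to\mathbb{C}^n$ be an arc ($I=[0,1]$ or $I=[0,1)$) with $\gamma(0)\in U$. A regular analytic continuation of $(U,f)$ along $\gamma$ is a regular analytic continuation $(S,\pi,j,G)$ of $(U,f)$ for which there is an arc $\widetilde\gamma:I\to S$ with $\pi\circ\widetilde\gamma=\gamma$ and $\widetilde\gamma(0)=j(\gamma(0))$ (the lifted arc). **Data of the Cauchy problem.** - A complex-analytic curve $\mathcal{B}=\{(z,w)\in\mathbb{C}^2: B(z,w)=0\}$, with $B$ holomorphic on $\mathbb{C}^2$ (the branch locus), and a proper Riemann domain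 $(\Delta,p)$ over $\mathbb{C}^2\setminus\mathcal{B}$. - A complex one-dimensional submanifold $\Sigma\subset\Delta$, with $\Delta\setminus\Sigma$ open, such that $p(\Sigma)$ (the singularity locus) is included in a complex-analytic curve $\{\Lambda(z,w)=0\}$ in $\mathbb{C}^2$. - The branch locus and the singularity locus are collectively called the singularities of the differential equation. - A holomorphic function $F$ on $\Delta\setminus\Sigma$ (the known term). - A point $X_0\in\Delta\setminus\Sigma$, with $(z_0,w_0):=p(X_0)$; $z_0$ is the initial point and $w_0$ the initial value. - A local inverse $\eta$ of $p$, defined on a bidisc $\mathbb{D}_1\times\mathbb{D}_2$ around $(z_0,w_0)$, with $\eta(z_0,w_0)=X_0$ and values in $\Delta\setminus\Sigma$. The initial solution $w$ is the holomorphic function on a disc around $z_0$, with graph in $\mathbb{D}_1\times\mathbb{D}_2$, solving $w'(z)=F\circ\eta(z,w(z))$, $w(z_0)=w_0$ (it exists and is locally unique by the classical existence and uniqueness theorem). *)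

theory Defs
  imports "HOL-Analysis.Analysis"
begin

section \<open>Finite-dimensional complex model spaces\<close>

text \<open>The distribution has no class of complex vector spaces.  The class below plays the role of
  \<open>\<complex>\<^sup>n\<close>, with \<open>DIM('a) = 2 * n\<close>; its instances \<^typ>\<open>complex\<close> and
  \<^typ>\<open>complex \<times> complex\<close> are \<open>\<complex>\<close> and \<open>\<complex>\<^sup>2\<close>.\<close>

class complex_euclidean_space = euclidean_space +
  fixes scaleC :: "complex \<Rightarrow> 'a \<Rightarrow> 'a"
  assumes scaleC_add_right: "scaleC c (x + y) = scaleC c x + scaleC c y"
    and scaleC_add_left: "scaleC (c + d) x = scaleC c x + scaleC d x"
    and scaleC_scaleC: "scaleC c (scaleC d x) = scaleC (c * d) x"
    and scaleC_of_real: "scaleC (complex_of_real r) x = r *\<^sub>R x"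
    and norm_scaleC: "norm (scaleC c x) = cmod c * norm x"

instantiation complex :: complex_euclidean_space
begin

definition scaleC_complex :: "complex \<Rightarrow> complex \<Rightarrow> complex"
  where "scaleC_complex c x = c * x"

instance
  by standard (simp_all add: scaleC_complex_def algebra_simps norm_mult scaleR_conv_of_real)

end

instantiation prod :: (complex_euclidean_space, complex_euclidean_space) complex_euclidean_space
begin

definition scaleC_prod :: "complex \<Rightarrow> 'a \<times> 'b \<Rightarrow> 'a \<times> 'b"
  where "scaleC_prod c x = (scaleC c (fst x), scaleC c (snd x))"

instance
proof
  fix c :: complex and x :: "'a \<times> 'b"
  show "norm (scaleC c x) = cmod c * norm x"
    by (simp add: scaleC_prod_def norm_prod_def norm_scaleC power_mult_distrib
        real_sqrt_mult flip: distrib_left)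
qed (simp_all add: scaleC_prod_def scaleC_add_right scaleC_add_left scaleC_scaleC
    scaleC_of_real prod_eq_iff)

end

definition complex_subspace :: "'a::complex_euclidean_space set \<Rightarrow> bool" where
  "complex_subspace L \<longleftrightarrow> subspace L \<and> (\<forall>c. \<forall>x\<in>L. scaleC c x \<in> L)"

text \<open>Holomorphy in several variables: complex Frechet differentiability.  It is only used on
  open sets.\<close>

definition mholomorphic_on ::
    "('a::complex_euclidean_space \<Rightarrow> 'b::complex_euclidean_space) \<Rightarrow> 'a set \<Rightarrow> bool"
    (infixl "mholomorphic'_on" 50) where
  "f mholomorphic_on A \<longleftrightarrow>
     (\<forall>x\<in>A. \<exists>D. (f has_derivative D) (at x) \<and> (\<forall>c v. D (scaleC c v) = scaleC c (D v)))"

lemma mholomorphic_on_iff_holomorphic_on: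
  fixes f :: "complex \<Rightarrow> complex"
  assumes "open A"
  shows "f mholomorphic_on A \<longleftrightarrow> f holomorphic_on A"
proof -
  have "(\<exists>D. (f has_derivative D) (at x) \<and> (\<forall>c v. D (c * v) = c * D v)) \<longleftrightarrow>
        (\<exists>d. (f has_field_derivative d) (at x))" for x
  proof
    assume "\<exists>D. (f has_derivative D) (at x) \<and> (\<forall>c v. D (c * v) = c * D v)"
    then obtain D where D: "(f has_derivative D) (at x)" "\<And>c v. D (c * v) = c * D v"
      by blast
    have "D = (*) (D 1)"
    proof
      fix v show "D v = D 1 * v"
        using D(2)[of v 1] by simp
    qed
    with D(1) show "\<exists>d. (f has_field_derivative d) (at x)"
      unfolding has_field_derivative_def by metis
  qed (auto simp: has_field_derivative_def mult_ac)
  then show ?thesis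
    using assms unfolding mholomorphic_on_def scaleC_complex_def
    by (simp add: holomorphic_on_open)
qed

text \<open>A complex-analytic curve in \<open>\<complex>\<^sup>2\<close>: the zero set of one holomorphic function on
  \<open>\<complex>\<^sup>2\<close> that does not vanish identically.  (With this convention the empty set is a curve.)\<close>

definition analytic_curve :: "(complex \<times> complex) set \<Rightarrow> bool" where
  "analytic_curve C \<longleftrightarrow>
     (\<exists>g :: complex \<times> complex \<Rightarrow> complex.
        g mholomorphic_on UNIV \<and> (\<exists>x. g x \<noteq> 0) \<and> C = {x. g x = 0})"


section \<open>Complex manifolds\<close>

text \<open>A chart is a pair of its domain and a map into the model space; the values of the map
  outside the domain are irrelevant.\<close>

record ('a, 'e) cmfd =
  mtop :: "'a topology"
  atlas :: "('a set \<times> ('a \<Rightarrow> 'e)) set"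

abbreviation points :: "('a, 'e) cmfd \<Rightarrow> 'a set" where
  "points M \<equiv> topspace (mtop M)"

definition holomorphic_chart ::
    "('a, 'e::complex_euclidean_space) cmfd \<Rightarrow> 'a set \<Rightarrow> ('a \<Rightarrow> 'e) \<Rightarrow> bool" where
  "holomorphic_chart M U \<phi> \<longleftrightarrow>
     openin (mtop M) U \<and> open (\<phi> ` U) \<and>
     homeomorphic_map (subtopology (mtop M) U) (top_of_set (\<phi> ` U)) \<phi> \<and>
     (\<forall>(V, \<psi>) \<in> atlas M.
        (\<psi> \<circ> inv_into U \<phi>) mholomorphic_on \<phi> ` (U \<inter> V) \<and>
        (\<phi> \<circ> inv_into V \<psi>) mholomorphic_on \<psi> ` (U \<inter> V))"

definition complex_manifold :: "('a, 'e::complex_euclidean_space) cmfd \<Rightarrow> bool" where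
  "complex_manifold M \<longleftrightarrow>
     Hausdorff_space (mtop M) \<and> second_countable (mtop M) \<and>
     (\<forall>(U, \<phi>) \<in> atlas M. holomorphic_chart M U \<phi>) \<and>
     points M = (\<Union>(U, \<phi>) \<in> atlas M. U)"

definition open_domain :: "'e set \<Rightarrow> ('e, 'e::complex_euclidean_space) cmfd" where
  "open_domain U = \<lparr>mtop = top_of_set U, atlas = {(U, id)}\<rparr>"

definition open_submanifold :: "('a, 'e) cmfd \<Rightarrow> 'a set \<Rightarrow> ('a, 'e) cmfd" where
  "open_submanifold M W =
     \<lparr>mtop = subtopology (mtop M) W, atlas = (\<lambda>(U, \<phi>). (U \<inter> W, \<phi>)) ` atlas M\<rparr>"

lemma complex_manifold_open_domain:
  assumes "open U"
  shows "complex_manifold (open_domain U)"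
proof -
  have hol: "(id \<circ> inv_into U id) mholomorphic_on U"
    unfolding mholomorphic_on_def
  proof
    fix x assume x: "x \<in> U"
    have "((\<lambda>y. y) has_derivative (\<lambda>v. v)) (at x)" by simp
    then have "((id \<circ> inv_into U id) has_derivative (\<lambda>v. v)) (at x)"
      by (rule has_derivative_transform_within_open[OF _ assms x])
        (metis comp_apply f_inv_into_f id_apply image_id)
    then show "\<exists>D. ((id \<circ> inv_into U id) has_derivative D) (at x) \<and>
        (\<forall>c v. D (scaleC c v) = scaleC c (D v))" by blast
  qed
  obtain B :: "'a set set" where B: "countable B" "topological_basis B"
    using ex_countable_basis by blast
  then have "second_countable (euclidean :: 'a topology)"
    unfolding second_countable_def
    by (metis open_openin topological_basisE topological_basis_open)
  then have "second_countable (top_of_set U)"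
    by (rule second_countable_subtopology)
  then show ?thesis
    using assms hol
    by (auto simp: complex_manifold_def open_domain_def holomorphic_chart_def
        Hausdorff_space_subtopology homeomorphic_map_id subtopology_subtopology)
qed

definition holomorphic_map ::
    "('a, 'e::complex_euclidean_space) cmfd \<Rightarrow> ('b, 'f::complex_euclidean_space) cmfd \<Rightarrow>
     ('a \<Rightarrow> 'b) \<Rightarrow> bool" where
  "holomorphic_map M N f \<longleftrightarrow>
     continuous_map (mtop M) (mtop N) f \<and>
     (\<forall>(U, \<phi>) \<in> atlas M. \<forall>(V, \<psi>) \<in> atlas N.
        (\<psi> \<circ> f \<circ> inv_into U \<phi>) mholomorphic_on \<phi> ` {x \<in> U. f x \<in> V})"

text \<open>\<open>D\<close> is the differential of \<open>f\<close> at \<open>x\<close> expressed in some pair of charts; rank and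
  injectivity of \<open>D\<close> do not depend on the charts.\<close>

definition has_chart_derivative ::
    "('a, 'e::complex_euclidean_space) cmfd \<Rightarrow> ('b, 'f::complex_euclidean_space) cmfd \<Rightarrow>
     ('a \<Rightarrow> 'b) \<Rightarrow> 'a \<Rightarrow> ('e \<Rightarrow> 'f) \<Rightarrow> bool" where
  "has_chart_derivative M N f x D \<longleftrightarrow>
     (\<exists>(U, \<phi>) \<in> atlas M. \<exists>(V, \<psi>) \<in> atlas N. x \<in> U \<and> f x \<in> V \<and>
        ((\<psi> \<circ> f \<circ> inv_into U \<phi>) has_derivative D) (at (\<phi> x)))"

text \<open>Both sides of the rank equation are real dimensions, i.e. twice the complex ones.\<close>

definition maximum_rank ::
    "('a, 'e::complex_euclidean_space) cmfd \<Rightarrow> ('b, 'f::complex_euclidean_space) cmfd \<Rightarrow>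
     ('a \<Rightarrow> 'b) \<Rightarrow> bool" where
  "maximum_rank M N f \<longleftrightarrow>
     (\<forall>x \<in> points M. \<exists>D. has_chart_derivative M N f x D \<and>
        dim (range D) = min DIM('e) DIM('f))"

definition holomorphic_immersion ::
    "('a, 'e::complex_euclidean_space) cmfd \<Rightarrow> ('b, 'f::complex_euclidean_space) cmfd \<Rightarrow>
     ('a \<Rightarrow> 'b) \<Rightarrow> bool" where
  "holomorphic_immersion M N f \<longleftrightarrow>
     holomorphic_map M N f \<and>
     (\<forall>x \<in> points M. \<exists>D. has_chart_derivative M N f x D \<and> inj D)"

text \<open>A complex submanifold of complex dimension \<open>k\<close>: near each of its points it is a slice in
  some holomorphic chart.  It need not be closed.\<close>

definition complex_submanifold ::
    "nat \<Rightarrow> ('a, 'e::complex_euclidean_space) cmfd \<Rightarrow> 'a set \<Rightarrow> bool" where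
  "complex_submanifold k M \<Sigma> \<longleftrightarrow>
     \<Sigma> \<subseteq> points M \<and>
     (\<forall>x \<in> \<Sigma>. \<exists>U \<phi> L. holomorphic_chart M U \<phi> \<and> x \<in> U \<and>
        complex_subspace L \<and> dim L = 2 * k \<and> \<phi> ` (\<Sigma> \<inter> U) = \<phi> ` U \<inter> L)"


section \<open>Riemann domains and regular analytic continuation\<close>

text \<open>\<open>M\<close> and \<open>\<U>\<close> have the same dimension since they share the model space \<open>'e\<close>.\<close>

definition riemann_domain ::
    "'e set \<Rightarrow> ('a, 'e::complex_euclidean_space) cmfd \<Rightarrow> ('a \<Rightarrow> 'e) \<Rightarrow> bool" where
  "riemann_domain \<U> M p \<longleftrightarrow>
     open \<U> \<and> connected \<U> \<and> \<U> \<noteq> {} \<and>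
     complex_manifold M \<and>
     holomorphic_map M (open_domain \<U>) p \<and> maximum_rank M (open_domain \<U>) p \<and>
     p ` points M = \<U>"

definition proper_riemann_domain ::
    "'e set \<Rightarrow> ('a, 'e::complex_euclidean_space) cmfd \<Rightarrow> ('a \<Rightarrow> 'e) \<Rightarrow> bool" where
  "proper_riemann_domain \<U> M p \<longleftrightarrow>
     riemann_domain \<U> M p \<and> proper_map (mtop M) (top_of_set \<U>) p"

text \<open>The region over which \<open>S\<close> is spread is \<open>\<pi>(S)\<close>.\<close>

definition regular_continuation ::
    "'e set \<Rightarrow> ('e \<Rightarrow> 'b) \<Rightarrow> ('b, 'f::complex_euclidean_space) cmfd \<Rightarrow>
     ('a, 'e::complex_euclidean_space) cmfd \<Rightarrow> ('a \<Rightarrow> 'e) \<Rightarrow> ('e \<Rightarrow> 'a) \<Rightarrow> ('a \<Rightarrow> 'b) \<Rightarrow> bool"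
  where
  "regular_continuation U f M S \<pi> j G \<longleftrightarrow>
     connected_space (mtop S) \<and> riemann_domain (\<pi> ` points S) S \<pi> \<and>
     U \<subseteq> \<pi> ` points S \<and>
     holomorphic_immersion (open_domain U) S j \<and> (\<forall>z\<in>U. \<pi> (j z) = z) \<and>
     holomorphic_map S M G \<and> (\<forall>z\<in>U. G (j z) = f z)"

definition lifted_arc ::
    "real set \<Rightarrow> (real \<Rightarrow> 'e) \<Rightarrow> ('a, 'e) cmfd \<Rightarrow> ('a \<Rightarrow> 'e) \<Rightarrow> ('e \<Rightarrow> 'a) \<Rightarrow> (real \<Rightarrow> 'a) \<Rightarrow> bool"
  where
  "lifted_arc I \<gamma> S \<pi> j \<gamma>' \<longleftrightarrow>
     continuous_map (top_of_set I) (mtop S) \<gamma>' \<and>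
     (\<forall>t\<in>I. \<pi> (\<gamma>' t) = \<gamma> t) \<and> \<gamma>' 0 = j (\<gamma> 0)"

definition regular_continuation_along ::
    "real set \<Rightarrow> (real \<Rightarrow> 'e) \<Rightarrow>
     'e set \<Rightarrow> ('e \<Rightarrow> 'b) \<Rightarrow> ('b, 'f::complex_euclidean_space) cmfd \<Rightarrow>
     ('a, 'e::complex_euclidean_space) cmfd \<Rightarrow> ('a \<Rightarrow> 'e) \<Rightarrow> ('e \<Rightarrow> 'a) \<Rightarrow> ('a \<Rightarrow> 'b) \<Rightarrow> bool"
  where
  "regular_continuation_along I \<gamma> U f M S \<pi> j G \<longleftrightarrow>
     regular_continuation U f M S \<pi> j G \<and> (\<exists>\<gamma>'. lifted_arc I \<gamma> S \<pi> j \<gamma>')"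


section \<open>The Cauchy problem\<close>

text \<open>\<open>\<B>\<close> is the branch locus, \<open>\<Sigma>\<close> lies over the singularity locus, \<open>F\<close> is the known term,
  and \<open>\<eta>\<close> is the local inverse of \<open>p\<close> on the bidisc of radii \<open>r1\<close>, \<open>r2\<close> around \<open>(z0, w0)\<close>.\<close>

definition cauchy_data ::
    "(complex \<times> complex) set \<Rightarrow> ('d, complex \<times> complex) cmfd \<Rightarrow> ('d \<Rightarrow> complex \<times> complex) \<Rightarrow>
     'd set \<Rightarrow> ('d \<Rightarrow> complex) \<Rightarrow> 'd \<Rightarrow> complex \<Rightarrow> complex \<Rightarrow>
     real \<Rightarrow> real \<Rightarrow> (complex \<times> complex \<Rightarrow> 'd) \<Rightarrow> bool" where
  "cauchy_data \<B> \<Delta> p \<Sigma> F X0 z0 w0 r1 r2 \<eta> \<longleftrightarrow>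
     analytic_curve \<B> \<and> proper_riemann_domain (- \<B>) \<Delta> p \<and>
     complex_submanifold 1 \<Delta> \<Sigma> \<and> openin (mtop \<Delta>) (points \<Delta> - \<Sigma>) \<and>
     (\<exists>C. analytic_curve C \<and> p ` \<Sigma> \<subseteq> C) \<and>
     holomorphic_map (open_submanifold \<Delta> (points \<Delta> - \<Sigma>)) (open_domain UNIV) F \<and>
     X0 \<in> points \<Delta> - \<Sigma> \<and> p X0 = (z0, w0) \<and>
     r1 > 0 \<and> r2 > 0 \<and>
     holomorphic_map (open_domain (ball z0 r1 \<times> ball w0 r2)) \<Delta> \<eta> \<and>
     (\<forall>x \<in> ball z0 r1 \<times> ball w0 r2. p (\<eta> x) = x \<and> \<eta> x \<in> points \<Delta> - \<Sigma>) \<and>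
     \<eta> (z0, w0) = X0"

definition initial_solution ::
    "('d \<Rightarrow> complex) \<Rightarrow> complex \<Rightarrow> complex \<Rightarrow> real \<Rightarrow> real \<Rightarrow> (complex \<times> complex \<Rightarrow> 'd) \<Rightarrow>
     real \<Rightarrow> (complex \<Rightarrow> complex) \<Rightarrow> bool" where
  "initial_solution F z0 w0 r1 r2 \<eta> r w \<longleftrightarrow>
     r > 0 \<and> w holomorphic_on ball z0 r \<and>
     (\<forall>z \<in> ball z0 r. (z, w z) \<in> ball z0 r1 \<times> ball w0 r2 \<and>
        (w has_field_derivative F (\<eta> (z, w z))) (at z)) \<and>
     w z0 = w0"

end

theory Submission
  imports Defs "HOL-Complex_Analysis.Complex_Analysis"
begin

text \<open>Let \<open>x1 = \<gamma> 1\<close>.  The vertical line over \<open>x1\<close> meets \<open>\<S>\<close> in a countable closed set.  If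
  \<open>\<omega> \<circ> \<gamma>'\<close> had no limit in the Riemann sphere, then, crossing infinitely often a circle that avoids
  this countable set, it would have a finite cluster point \<open>v0\<close> with \<open>(x1, v0) \<notin> \<S>\<close>.  Near \<open>(x1, v0)\<close>
  the proper map \<open>p\<close> is a finite covering, so the equation has only finitely many holomorphic
  right-hand sides there and its solutions through nearby points all exist on a common disc around
  \<open>x1\<close>.  By the identity theorem \<open>\<omega>\<close> solves one of these equations wherever its graph is off \<open>\<S>\<close>,
  so from some time on it coincides with such a solution and converges after all.  If the graph lies
  entirely in \<open>\<S>\<close>, the point \<open>v0\<close> cannot exist to begin with.\<close>

section \<open>Complex differentiability in several variables\<close>

text \<open>Two obstacles shape the argument. Over \<open>\<S>\<close> the covering and the known
  term may degenerate, while the graph of the continued function may cross \<open>\<S>\<close>, so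
  the equation cannot simply be carried along the arc. The way around is that in a disc the graph
  meets \<open>\<S>\<close> only in a countable set unless it stays inside \<open>\<S>\<close>, and
  a disc minus a countable set is still connected. Moreover, the branch that the continuation solves
  is known only at the moment when the graph comes close to \<open>(x1, v0)\<close>, yet the
  required closeness depends on the branch; finiteness of the covering gives one closeness that
  serves all branches. The manifolds enter only through local sections: \<open>R\<close> and the
  lifted arc become a family of plane germs \<open>h t\<close>, and \<open>\<Delta>\<close> becomes,
  locally, a finite list of functions of two variables. Producing sections takes an inverse function
  theorem, hence a continuous derivative, whereas holomorphy is defined by mere complex
  differentiability; Cauchy's estimate bridges this gap.\<close>

lemma mholomorphic_onI:
  assumes "\<And>x. x \<in> A \<Longrightarrow> (f has_derivative D x) (at x)"
    and "\<And>x c v. x \<in> A \<Longrightarrow> D x (scaleC c v) = scaleC c (D x v)"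
  shows "f mholomorphic_on A"
  using assms unfolding mholomorphic_on_def by blast

text \<open>A derivative at a point is unique, so the witness in the definition can be replaced by
  \<open>frechet_derivative\<close>, whose dependence on the point can then be studied.\<close>

lemma mholomorphic_on_frechet:
  assumes "f mholomorphic_on A" "x \<in> A"
  shows "(f has_derivative frechet_derivative f (at x)) (at x)"
    and "frechet_derivative f (at x) (scaleC c v) = scaleC c (frechet_derivative f (at x) v)"
proof -
  obtain D where D: "(f has_derivative D) (at x)" "\<And>c v. D (scaleC c v) = scaleC c (D v)"
    using assms unfolding mholomorphic_on_def by blast
  then have "D = frechet_derivative f (at x)"
    by (simp add: frechet_derivative_at)
  with D show "(f has_derivative frechet_derivative f (at x)) (at x)"
    "frechet_derivative f (at x) (scaleC c v) = scaleC c (frechet_derivative f (at x) v)"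
    by auto
qed

lemma mholomorphic_on_subset: "f mholomorphic_on A \<Longrightarrow> B \<subseteq> A \<Longrightarrow> f mholomorphic_on B"
  unfolding mholomorphic_on_def by blast

lemma mholomorphic_on_imp_continuous_on: "f mholomorphic_on A \<Longrightarrow> continuous_on A f"
  unfolding mholomorphic_on_def
  by (meson continuous_at_imp_continuous_on has_derivative_continuous)

lemma mholomorphic_on_cong:
  assumes "f mholomorphic_on A" "open A" "\<And>x. x \<in> A \<Longrightarrow> f x = g x"
  shows "g mholomorphic_on A"
  unfolding mholomorphic_on_def
  by (metis assms has_derivative_transform_within_open mholomorphic_on_def)

lemma mholomorphic_on_compose:
  assumes "f mholomorphic_on A" "g mholomorphic_on B" "f ` A \<subseteq> B"
  shows "(g \<circ> f) mholomorphic_on A"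
proof (rule mholomorphic_onI)
  fix x c v assume x: "x \<in> A"
  then have "f x \<in> B" using assms(3) by auto
  let ?D = "frechet_derivative g (at (f x)) \<circ> frechet_derivative f (at x)"
  show "(g \<circ> f has_derivative ?D) (at x)"
    using mholomorphic_on_frechet(1)[OF assms(1) x] mholomorphic_on_frechet(1)[OF assms(2) \<open>f x \<in> B\<close>]
    by (rule diff_chain_at)
  show "?D (scaleC c v) = scaleC c (?D v)"
    using mholomorphic_on_frechet(2)[OF assms(1) x] mholomorphic_on_frechet(2)[OF assms(2) \<open>f x \<in> B\<close>]
    by simp
qed

text \<open>Brings matters back to one variable: the curve equation and the branches of the
  right-hand side, evaluated along a graph, become functions to which the one-variable identity
  theorem applies.\<close>

lemma holomorphic_graph_compose:
  assumes g: "g mholomorphic_on A" and f: "f holomorphic_on N" "open N"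
    and sub: "\<And>z. z \<in> N \<Longrightarrow> (z, f z) \<in> A"
  shows "(\<lambda>z. g (z, f z) :: complex) holomorphic_on N"
proof -
  have "f mholomorphic_on N" using f by (simp add: mholomorphic_on_iff_holomorphic_on)
  then have "(\<lambda>z. (z, f z)) mholomorphic_on N"
    unfolding mholomorphic_on_def
    apply safe
    subgoal for x
      apply (drule bspec, assumption)
      apply safe
      subgoal for D
        by (rule exI[of _ "\<lambda>v. (v, D v)"])
          (auto intro!: derivative_eq_intros simp: scaleC_prod_def scaleC_complex_def)
      done
    done
  from mholomorphic_on_compose[OF this g] sub
  have "(g \<circ> (\<lambda>z. (z, f z))) mholomorphic_on N" by auto
  with f show ?thesis by (simp add: mholomorphic_on_iff_holomorphic_on o_def)
qed

lemma scaleC_minus_1: "scaleC (-1) x = - (x :: 'a::complex_euclidean_space)"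
  using scaleC_of_real[of "-1" x] by simp

lemma bounded_linear_scaleC: "bounded_linear (\<lambda>c. scaleC c (v :: 'a::complex_euclidean_space))"
proof (rule bounded_linear_intro[where K = "norm v"])
  fix r c
  have "scaleC (r *\<^sub>R c) v = scaleC (complex_of_real r) (scaleC c v)"
    by (simp add: scaleC_scaleC scaleR_conv_of_real)
  then show "scaleC (r *\<^sub>R c) v = r *\<^sub>R scaleC c v"
    by (simp add: scaleC_of_real)
qed (simp_all add: scaleC_add_left norm_scaleC)

text \<open>Complex linearity of the derivative turns the directional derivative along
  \<open>v\<close> into an ordinary complex derivative, which Cauchy's estimate can bound.\<close>

lemma holomorphic_on_line:
  assumes f: "(f :: 'a::complex_euclidean_space \<Rightarrow> complex) mholomorphic_on A"
    and sub: "\<And>c. c \<in> N \<Longrightarrow> x + scaleC c v \<in> A" and N: "open N"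
  shows "(\<lambda>c. f (x + scaleC c v)) holomorphic_on N"
    and "c \<in> N \<Longrightarrow> deriv (\<lambda>c. f (x + scaleC c v)) c = frechet_derivative f (at (x + scaleC c v)) v"
proof -
  have D: "((\<lambda>c. f (x + scaleC c v)) has_field_derivative frechet_derivative f (at (x + scaleC c v)) v) (at c)"
    if "c \<in> N" for c
  proof -
    note fr = mholomorphic_on_frechet[OF f sub[OF that]]
    have "((\<lambda>c. x + scaleC c v) has_derivative (\<lambda>h. scaleC h v)) (at c)"
      using bounded_linear_scaleC by (auto intro!: derivative_eq_intros bounded_linear_imp_has_derivative)
    from diff_chain_at[OF this fr(1)]
    have "((\<lambda>c. f (x + scaleC c v)) has_derivative (\<lambda>h. frechet_derivative f (at (x + scaleC c v)) (scaleC h v))) (at c)"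
      by (simp only: o_def)
    moreover have "(\<lambda>h. frechet_derivative f (at (x + scaleC c v)) (scaleC h v)) =
        (*) (frechet_derivative f (at (x + scaleC c v)) v)"
      by (simp only: fr(2) scaleC_complex_def mult.commute fun_eq_iff) simp
    ultimately show ?thesis
      by (simp only: has_field_derivative_def)
  qed
  then show "(\<lambda>c. f (x + scaleC c v)) holomorphic_on N"
    using N by (auto simp: holomorphic_on_open)
  show "c \<in> N \<Longrightarrow> deriv (\<lambda>c. f (x + scaleC c v)) c = frechet_derivative f (at (x + scaleC c v)) v"
    using D DERIV_imp_deriv by blast
qed

text \<open>By Cauchy's estimate for \<open>c \<mapsto> f (x + c v) - f (x0 + c v)\<close>, which is uniformly small
  when \<open>x\<close> is close to \<open>x0\<close>.\<close>

lemma frechet_derivative_continuous_scalar: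
  assumes f: "(f :: 'a::complex_euclidean_space \<Rightarrow> complex) mholomorphic_on A"
    and A: "open A" "x0 \<in> A" and e: "e > 0"
  shows "\<exists>d>0. \<forall>x\<in>ball x0 d. \<forall>v. cmod (frechet_derivative f (at x) v - frechet_derivative f (at x0) v) \<le> e * norm v"
proof -
  obtain r where r: "r > 0" "cball x0 r \<subseteq> A"
    using A open_contains_cball by blast
  have "uniformly_continuous_on (cball x0 r) f"
    using f r by (intro compact_uniformly_continuous) (auto intro: continuous_on_subset mholomorphic_on_imp_continuous_on)
  moreover have "e * (r/2) > 0" using e r by simp
  ultimately obtain d where d: "d > 0"
    "\<And>x y. x \<in> cball x0 r \<Longrightarrow> y \<in> cball x0 r \<Longrightarrow> dist x y < d \<Longrightarrow> dist (f x) (f y) < e * (r/2)"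
    unfolding uniformly_continuous_on_def by metis
  show ?thesis
  \<comment> \<open>A shift by less than \<open>r/3\<close> plus a vector shorter than
    \<open>r/2 + r/10\<close> stays below \<open>r\<close>; the extra \<open>r/10\<close> gives an
    open disc around the closed disc of radius \<open>r/2\<close> used in Cauchy's estimate. There
    \<open>d\<close> bounds the difference by \<open>e * (r/2)\<close>, and division by
    \<open>r/2\<close> gives \<open>e\<close>.\<close>
  proof (intro exI[of _ "min d (r/3)"] conjI ballI allI)
    show "0 < min d (r/3)" using d r by auto
    fix x v assume x: "x \<in> ball x0 (min d (r/3))"
    define s where "s = r/2"
    let ?D = "\<lambda>x. frechet_derivative f (at x)"
    have lin: "linear (?D y)" if "y \<in> A" for y
      using mholomorphic_on_frechet(1)[OF f that] has_derivative_linear by blast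
    have unit: "cmod (?D x u - ?D x0 u) \<le> e" if u: "norm u = 1" for u
    proof -
      have mem: "x0 + scaleC c u \<in> cball x0 r" "x + scaleC c u \<in> cball x0 r" if "norm c < r/2 + r/10" for c
      proof -
        have "norm (scaleC c u) < r/2 + r/10" using that u by (simp add: norm_scaleC)
        then show "x0 + scaleC c u \<in> cball x0 r" using r by (simp add: dist_norm)
        have "dist x0 (x + scaleC c u) \<le> dist x0 x + dist x (x + scaleC c u)" by (rule dist_triangle)
        then show "x + scaleC c u \<in> cball x0 r"
          using x \<open>norm (scaleC c u) < r/2 + r/10\<close> r by (simp add: dist_norm)
      qed
      define k where "k = (\<lambda>c. f (x + scaleC c u) - f (x0 + scaleC c u))"
      let ?N = "ball (0::complex) (r/2 + r/10)"
      have h1: "(\<lambda>c. f (x + scaleC c u)) holomorphic_on ?N" "(\<lambda>c. f (x0 + scaleC c u)) holomorphic_on ?N"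
        using mem r by (auto intro!: holomorphic_on_line(1)[OF f])
      then have hk: "k holomorphic_on ?N"
        unfolding k_def by (rule holomorphic_on_diff)
      have z: "(0::complex) \<in> ?N" using r by simp
      have "deriv k 0 = deriv (\<lambda>c. f (x + scaleC c u)) 0 - deriv (\<lambda>c. f (x0 + scaleC c u)) 0"
        unfolding k_def using h1 z by (intro deriv_diff) (auto intro: holomorphic_on_imp_differentiable_at)
      moreover have "deriv (\<lambda>c. f (x + scaleC c u)) 0 = ?D (x + scaleC 0 u) u"
        using mem r by (intro holomorphic_on_line(2)[OF f _ _ z]) auto
      moreover have "deriv (\<lambda>c. f (x0 + scaleC c u)) 0 = ?D (x0 + scaleC 0 u) u"
        using mem r by (intro holomorphic_on_line(2)[OF f _ _ z]) auto
      moreover have "scaleC 0 u = 0" using scaleC_of_real[of 0 u] by simp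
      ultimately have dk: "deriv k 0 = ?D x u - ?D x0 u" by simp
      have "cmod ((deriv ^^ 1) k 0) \<le> fact 1 * (e * (r/2)) / (r/2) ^ 1"
      proof (rule Cauchy_inequality)
        have sub: "cball 0 (r/2) \<subseteq> ?N" using r by auto
        then show "k holomorphic_on ball 0 (r/2)"
          by (meson hk ball_subset_cball holomorphic_on_subset subset_trans)
        show "continuous_on (cball 0 (r/2)) k"
          using hk sub holomorphic_on_imp_continuous_on holomorphic_on_subset by blast
        show "0 < r/2" using r by simp
        fix c :: complex assume "cmod (0 - c) = r/2"
        then have "norm c < r/2 + r/10" using r by simp
        moreover have "dist (x + scaleC c u) (x0 + scaleC c u) < d"
          using x by (simp add: dist_norm norm_minus_commute)
        ultimately show "cmod (k c) \<le> e * (r/2)"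
          using d(2)[OF mem(2) mem(1), of c c] by (simp add: k_def dist_norm)
      qed
      then show ?thesis using r dk by simp
    qed
    have xA: "x \<in> A" "x0 \<in> A" using x r A by auto
    show "cmod (?D x v - ?D x0 v) \<le> e * norm v"
    proof (cases "v = 0")
      case True
      then show ?thesis using lin[OF xA(1)] lin[OF xA(2)] by (simp add: linear_0)
    next
      case False
      define u where "u = (1 / norm v) *\<^sub>R v"
      have "norm u = 1" "v = norm v *\<^sub>R u" using False by (auto simp: u_def)
      have "?D y v = norm v *\<^sub>R ?D y u" if "y \<in> A" for y
        by (subst \<open>v = norm v *\<^sub>R u\<close>) (rule linear_scale[OF lin[OF that]])
      then have "?D x v - ?D x0 v = norm v *\<^sub>R (?D x u - ?D x0 u)"
        using xA by (simp add: scaleR_diff_right)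
      then show ?thesis using mult_left_mono[OF unit[OF \<open>norm u = 1\<close>], of "norm v"]
        by (simp add: mult.commute)
    qed
  qed
qed

text \<open>The complex linear functional with real part \<open>v \<bullet> b\<close>.\<close>

definition complex_coord :: "'a::complex_euclidean_space \<Rightarrow> 'a \<Rightarrow> complex" where
  "complex_coord b v = Complex (v \<bullet> b) (- (scaleC \<i> v \<bullet> b))"

lemma scaleC_Complex: "scaleC c v = Re c *\<^sub>R v + Im c *\<^sub>R scaleC \<i> (v :: 'a::complex_euclidean_space)"
proof -
  have "scaleC c v = scaleC (of_real (Re c) + of_real (Im c) * \<i>) v"
    using complex_eq[of c] by (simp add: mult.commute)
  then show ?thesis
    by (simp only: scaleC_add_left scaleC_of_real flip: scaleC_scaleC)
qed

lemma complex_coord_scaleC: "complex_coord b (scaleC c v) = c * complex_coord b v"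
proof -
  have "scaleC \<i> (scaleC c v) = Re c *\<^sub>R scaleC \<i> v - Im c *\<^sub>R v"
  proof -
    have "scaleC \<i> (scaleC c v) = scaleC c (scaleC \<i> v)"
      by (simp add: scaleC_scaleC mult.commute)
    also have "\<dots> = Re c *\<^sub>R scaleC \<i> v + Im c *\<^sub>R scaleC (\<i> * \<i>) v"
      by (subst scaleC_Complex) (simp add: scaleC_scaleC)
    finally show ?thesis by (simp add: scaleC_minus_1)
  qed
  then show ?thesis
    by (simp add: complex_coord_def complex_eq_iff scaleC_Complex[of c v] inner_simps)
qed

lemma bounded_linear_scaleC_right: "bounded_linear (scaleC c :: 'a::complex_euclidean_space \<Rightarrow> 'a)"
proof (rule bounded_linear_intro[where K = "cmod c"])
  fix r and x :: 'a
  have "scaleC c (r *\<^sub>R x) = scaleC c (scaleC (of_real r) x)" by (simp add: scaleC_of_real)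
  then show "scaleC c (r *\<^sub>R x) = r *\<^sub>R scaleC c x"
    by (metis scaleC_of_real scaleC_scaleC mult.commute)
qed (simp_all add: scaleC_add_right norm_scaleC)

lemma bounded_linear_complex_coord: "bounded_linear (complex_coord b)"
proof -
  have "bounded_linear (\<lambda>v. of_real (v \<bullet> b) + \<i> * of_real (- (scaleC \<i> v \<bullet> b)))"
    by (intro bounded_linear_intros bounded_linear_compose[OF bounded_linear_inner_left]
         bounded_linear_compose[OF bounded_linear_of_real] bounded_linear_minus
         bounded_linear_compose[OF bounded_linear_mult_right] bounded_linear_scaleC_right bounded_linear_add)
  then show ?thesis
    by (simp add: complex_coord_def[abs_def] Complex_eq)
qed

text \<open>Each \<open>complex_coord b \<circ> f\<close> is a scalar holomorphic function, and the
  real part of its derivative is the \<open>b\<close>-component of the derivative of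
  \<open>f\<close>. The sum of these components over \<open>Basis\<close> controls the operator
  norm.\<close>

lemma frechet_derivative_continuous:
  assumes f: "(f :: 'a::complex_euclidean_space \<Rightarrow> 'b::complex_euclidean_space) mholomorphic_on A"
    and A: "open A"
  shows "continuous_on A (\<lambda>x. Blinfun (frechet_derivative f (at x)))"
proof -
  let ?D = "\<lambda>x. frechet_derivative f (at x)"
  have bl: "bounded_linear (?D x)" if "x \<in> A" for x
    using mholomorphic_on_frechet(1)[OF f that] has_derivative_bounded_linear by blast
  have "isCont (\<lambda>x. Blinfun (?D x)) x0" if x0: "x0 \<in> A" for x0
    unfolding continuous_at_eps_delta
  proof (intro allI impI)
    fix e :: real assume e: "e > 0"
    \<comment> \<open>\<open>DIM('b)\<close> components of size \<open>e' * norm v\<close> add up to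
      \<open>e/2 * norm v\<close>; the spare factor turns the non-strict operator bound into a
      strict one.\<close>
    define e' where "e' = e / (2 * DIM('b))"
    have e': "e' > 0" using e by (simp add: e'_def)
    have ex: "\<exists>d>0. \<forall>x\<in>ball x0 d. x \<in> A \<and> (\<forall>v. \<bar>(?D x v - ?D x0 v) \<bullet> b\<bar> \<le> e' * norm v)" for b :: 'b
    proof -
      let ?h = "complex_coord b \<circ> f"
      have der: "(?h has_derivative complex_coord b \<circ> ?D x) (at x)" if "x \<in> A" for x
        using diff_chain_at[OF mholomorphic_on_frechet(1)[OF f that]]
          bounded_linear_complex_coord bounded_linear_imp_has_derivative by blast
      then have eq: "frechet_derivative ?h (at x) = complex_coord b \<circ> ?D x" if "x \<in> A" for x
        using that by (metis frechet_derivative_at)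
      have "?h mholomorphic_on A"
        using der by (rule mholomorphic_onI)
          (auto simp: mholomorphic_on_frechet(2)[OF f] complex_coord_scaleC scaleC_complex_def)
      from frechet_derivative_continuous_scalar[OF this A x0 e']
      obtain d where d: "d > 0" "\<forall>x\<in>ball x0 d. \<forall>v. cmod (frechet_derivative ?h (at x) v - frechet_derivative ?h (at x0) v) \<le> e' * norm v"
        by blast
      obtain d' where d': "d' > 0" "ball x0 d' \<subseteq> A" using A x0 open_contains_ball by blast
      have "\<bar>(?D x v - ?D x0 v) \<bullet> b\<bar> \<le> e' * norm v" if "x \<in> ball x0 (min d d')" for x v
      proof -
        have "\<bar>Re (complex_coord b (?D x v) - complex_coord b (?D x0 v))\<bar> \<le> e' * norm v"
        proof (rule order_trans[OF abs_Re_le_cmod])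
          have "x \<in> ball x0 d" "x \<in> A" using that d'(2) by auto
          then show "cmod (complex_coord b (?D x v) - complex_coord b (?D x0 v)) \<le> e' * norm v"
            using d(2)[rule_format, of x v] by (simp only: eq[OF \<open>x \<in> A\<close>] eq[OF x0] comp_apply)
        qed
        moreover have "Re (complex_coord b (?D x v) - complex_coord b (?D x0 v)) = (?D x v - ?D x0 v) \<bullet> b"
          by (simp only: complex_coord_def inner_diff_left minus_complex.sel complex.sel)
        ultimately show ?thesis by (simp only:)
      qed
      then show ?thesis
        using d(1) d' by (intro exI[of _ "min d d'"] conjI ballI allI) auto
    qed
    have "\<exists>d. \<forall>b::'b. d b > 0 \<and>
        (\<forall>x\<in>ball x0 (d b). x \<in> A \<and> (\<forall>v. \<bar>(?D x v - ?D x0 v) \<bullet> b\<bar> \<le> e' * norm v))"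
      by (rule choice, rule allI, rule ex)
    then obtain d where d: "\<And>b. d b > 0" "\<And>b x. x \<in> ball x0 (d b) \<Longrightarrow> x \<in> A"
      "\<And>b x v. x \<in> ball x0 (d b) \<Longrightarrow> \<bar>(?D x v - ?D x0 v) \<bullet> (b::'b)\<bar> \<le> e' * norm v"
      by blast
    define \<delta> where "\<delta> = Min (d ` Basis)"
    have \<delta>: "\<delta> > 0" unfolding \<delta>_def using d(1) by (subst Min_gr_iff) auto
    show "\<exists>d>0. \<forall>x'. dist x' x0 < d \<longrightarrow> dist (Blinfun (?D x')) (Blinfun (?D x0)) < e"
    proof (intro exI[of _ \<delta>] conjI allI impI \<delta>)
      fix x assume "dist x x0 < \<delta>"
      then have xb: "x \<in> ball x0 (d b)" if "b \<in> Basis" for b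
        using that unfolding \<delta>_def by (simp add: dist_commute)
      have xA: "x \<in> A" using xb d(2) nonempty_Basis by blast
      have "norm (Blinfun (?D x) - Blinfun (?D x0)) \<le> e/2"
      proof (rule norm_blinfun_bound)
        show "0 \<le> e/2" using e by simp
        fix v
        have "norm (?D x v - ?D x0 v) \<le> (\<Sum>b\<in>Basis. \<bar>(?D x v - ?D x0 v) \<bullet> b\<bar>)"
          by (rule norm_le_l1)
        also have "\<dots> \<le> (\<Sum>b\<in>(Basis::'b set). e' * norm v)"
          using d(3)[OF xb] by (rule sum_mono)
        also have "\<dots> = e/2 * norm v" by (simp add: e'_def)
        finally show "norm (blinfun_apply (Blinfun (?D x) - Blinfun (?D x0)) v) \<le> e/2 * norm v"
          using bl xA x0 by (simp add: blinfun.diff_left bounded_linear_Blinfun_apply)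
      qed
      then show "dist (Blinfun (?D x)) (Blinfun (?D x0)) < e"
        using e by (simp add: dist_norm)
    qed
  qed
  then show ?thesis using continuous_at_imp_continuous_on by blast
qed

text \<open>The real inverse function theorem does the analysis; injectivity of \<open>D\<close>
  supplies the left inverse it asks for. Holomorphy of \<open>g\<close> is then algebra: the inverse
  of a complex linear bijection is complex linear.\<close>

lemma mholomorphic_local_inverse:
  assumes f: "(f :: 'a::complex_euclidean_space \<Rightarrow> 'a) mholomorphic_on A"
    and A: "open A" "x0 \<in> A"
    and D: "(f has_derivative D) (at x0)" "inj D"
  obtains U V g where "open U" "U \<subseteq> A" "x0 \<in> U" "open V" "homeomorphism U V f g"
    "g mholomorphic_on V"
proof -
  let ?D = "\<lambda>x. frechet_derivative f (at x)"
  note fr = mholomorphic_on_frechet[OF f]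
  have bl: "bounded_linear (?D x)" if "x \<in> A" for x
    using fr(1)[OF that] has_derivative_bounded_linear by blast
  have DD: "D = ?D x0" using D(1) frechet_derivative_at by blast
  have "linear D" using D(1) has_derivative_linear by blast
  then obtain E where E: "linear E" "E \<circ> D = id"
    using D(2) linear_injective_left_inverse by blast
  have blE: "bounded_linear E" using E(1) linear_conv_bounded_linear by blast
  have inv: "Blinfun E o\<^sub>L Blinfun (?D x0) = id_blinfun"
    using E(2) DD bl[OF A(2)] blE
    by (intro blinfun_eqI) (simp add: bounded_linear_Blinfun_apply pointfree_idE)
  have der: "(f has_derivative blinfun_apply (Blinfun (?D x))) (at x)" if "x \<in> A" for x
    using fr(1)[OF that] bl[OF that] by (simp add: bounded_linear_Blinfun_apply)
  obtain U V g g' where *: "open U" "U \<subseteq> A" "x0 \<in> U" "open V" "f x0 \<in> V" "homeomorphism U V f g"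
    "\<And>y. y \<in> V \<Longrightarrow> (g has_derivative g' y) (at y)"
    "\<And>y. y \<in> V \<Longrightarrow> g' y = inv (blinfun_apply (Blinfun (?D (g y))))"
    "\<And>y. y \<in> V \<Longrightarrow> bij (blinfun_apply (Blinfun (?D (g y))))"
    using inverse_function_theorem[OF A(1) der frechet_derivative_continuous[OF f A(1)] A(2) inv] by metis
  have "g mholomorphic_on V"
  proof (rule mholomorphic_onI[OF *(7)])
    fix y c v assume y: "y \<in> V"
    have gy: "g y \<in> A" using *(2,6) y by (auto simp: homeomorphism_def)
    have b: "bij (?D (g y))" and g': "g' y = inv (?D (g y))"
      using *(8,9)[OF y] bl[OF gy] by (auto simp: bounded_linear_Blinfun_apply)
    have "?D (g y) (scaleC c (g' y v)) = scaleC c v"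
      using fr(2)[OF gy] b g' by (simp add: bij_is_surj surj_f_inv_f)
    then show "g' y (scaleC c v) = scaleC c (g' y v)"
      using b g' by (metis bij_inv_eq_iff)
  qed
  with * show thesis by (auto intro: that)
qed

section \<open>Local sections of Riemann domains\<close>

text \<open>Continuity is enough here: compared with a \<open>holomorphic_section\<close> through
  the same point, such a section is forced to have the same germ. This lets \<open>\<eta>\<close>,
  \<open>j\<close> and arbitrary branches be treated alike.\<close>

definition local_section :: "('a, 'e::complex_euclidean_space) cmfd \<Rightarrow> ('a \<Rightarrow> 'e) \<Rightarrow> 'e set \<Rightarrow> ('e \<Rightarrow> 'a) \<Rightarrow> bool" where
  "local_section M p V \<sigma> \<longleftrightarrow>
     open V \<and> continuous_map (top_of_set V) (mtop M) \<sigma> \<and> (\<forall>y\<in>V. p (\<sigma> y) = y)"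

lemma local_section_in_points: "local_section M p V \<sigma> \<Longrightarrow> y \<in> V \<Longrightarrow> \<sigma> y \<in> points M"
  unfolding local_section_def continuous_map_def by auto

lemma local_section_subset:
  "local_section M p V \<sigma> \<Longrightarrow> open W \<Longrightarrow> W \<subseteq> V \<Longrightarrow> local_section M p W \<sigma>"
  unfolding local_section_def by (auto intro: continuous_map_from_subtopology_mono)

lemma local_section_preimage_open:
  assumes "local_section M p V \<sigma>" "openin (mtop M) N"
  shows "open {y \<in> V. \<sigma> y \<in> N}"
proof -
  have "openin (top_of_set V) {y \<in> topspace (top_of_set V). \<sigma> y \<in> N}"
    using assms unfolding local_section_def by (blast intro: openin_continuous_map_preimage)
  then show ?thesis
    using assms by (simp add: local_section_def openin_open_eq)
qed

text \<open>The open image gives uniqueness of germs; an image inside a single atlas chart allows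
  composition with a holomorphic map without patching charts.\<close>

definition holomorphic_section :: "('a, 'e::complex_euclidean_space) cmfd \<Rightarrow> ('a \<Rightarrow> 'e) \<Rightarrow> 'e set \<Rightarrow> ('e \<Rightarrow> 'a) \<Rightarrow> bool" where
  "holomorphic_section M p V \<sigma> \<longleftrightarrow>
     local_section M p V \<sigma> \<and> openin (mtop M) (\<sigma> ` V) \<and>
     (\<exists>(U, \<phi>) \<in> atlas M. \<sigma> ` V \<subseteq> U \<and> (\<phi> \<circ> \<sigma>) mholomorphic_on V)"

text \<open>In a chart, \<open>p\<close> becomes a map between open subsets of the same model space,
  so maximum rank makes its derivative invertible; the section is the local inverse read back
  through the chart.\<close>

lemma holomorphic_section_exists:
  fixes M :: "('a, 'e::complex_euclidean_space) cmfd"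
  assumes M: "riemann_domain \<U> M p" and x: "x \<in> points M"
  obtains V \<sigma> where "holomorphic_section M p V \<sigma>" "p x \<in> V" "V \<subseteq> \<U>" "\<sigma> (p x) = x"
proof -
  have mfd: "complex_manifold M" and hol: "holomorphic_map M (open_domain \<U>) p"
    and mr: "maximum_rank M (open_domain \<U>) p" and im: "p ` points M = \<U>"
    using M by (auto simp: riemann_domain_def)
  obtain D where D: "has_chart_derivative M (open_domain \<U>) p x D" "dim (range D) = DIM('e)"
    using mr x unfolding maximum_rank_def by auto
  then obtain U \<phi> where U: "(U, \<phi>) \<in> atlas M" "x \<in> U"
    "((id \<circ> p \<circ> inv_into U \<phi>) has_derivative D) (at (\<phi> x))"
    unfolding has_chart_derivative_def open_domain_def by auto
  have ch: "holomorphic_chart M U \<phi>" using mfd U by (auto simp: complex_manifold_def)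
  then have oU: "openin (mtop M) U" and oA: "open (\<phi> ` U)"
    and hm: "homeomorphic_map (subtopology (mtop M) U) (top_of_set (\<phi> ` U)) \<phi>"
    by (auto simp: holomorphic_chart_def)
  have tU: "topspace (subtopology (mtop M) U) = U"
    using openin_subset[OF oU] by (simp add: topspace_subtopology Int_absorb1)
  then have inj: "inj_on \<phi> U" using hm by (simp add: homeomorphic_map_def)
  have pU: "p ` U \<subseteq> \<U>" using im openin_subset[OF oU] by blast
  define k where "k = id \<circ> p \<circ> inv_into U \<phi>"
  have "k mholomorphic_on \<phi> ` {y \<in> U. p y \<in> \<U>}"
    using hol U(1) unfolding holomorphic_map_def open_domain_def k_def by auto
  moreover have "{y \<in> U. p y \<in> \<U>} = U" using pU by auto
  ultimately have k: "k mholomorphic_on \<phi> ` U" by simp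
  have dk: "(k has_derivative D) (at (\<phi> x))" using U(3) by (simp only: k_def)
  have lin: "linear D" using dk has_derivative_linear by blast
  have "surj D"
    using D(2) lin by (metis dim_eq_full linear_subspace_image span_eq_iff subspace_UNIV)
  then have "inj D" using lin linear_surjective_imp_injective by blast
  from mholomorphic_local_inverse[OF k oA imageI[OF U(2)] dk this]
  obtain A V g where A: "open A" "A \<subseteq> \<phi> ` U" "\<phi> x \<in> A" "open V" "homeomorphism A V k g"
    "g mholomorphic_on V" by metis
  define \<sigma> where "\<sigma> = inv_into U \<phi> \<circ> g"
  have gV: "g ` V = A" "\<And>y. y \<in> V \<Longrightarrow> k (g y) = y" "\<And>y. y \<in> A \<Longrightarrow> g (k y) = y" "k ` A = V"
    using A(5) by (auto simp: homeomorphism_def)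
  have ik: "inv_into U \<phi> (\<phi> y) = y" if "y \<in> U" for y using inj that by simp
  have \<phi>\<sigma>: "\<phi> (\<sigma> y) = g y" "\<sigma> y \<in> U" if "y \<in> V" for y
    using gV(1) A(2) that by (auto simp: \<sigma>_def f_inv_into_f inv_into_into subset_iff)
  have p\<sigma>: "p (\<sigma> y) = y" if "y \<in> V" for y
    using gV(2)[OF that] by (simp add: k_def \<sigma>_def)
  have kx: "k (\<phi> x) = p x" using ik[OF U(2)] by (simp add: k_def)
  have px: "p x \<in> V" using imageI[OF A(3), of k] by (simp only: gV(4) kx)
  have \<sigma>x: "\<sigma> (p x) = x" using gV(3)[OF A(3)] ik[OF U(2)] by (simp add: kx \<sigma>_def)
  obtain h where h: "homeomorphic_maps (subtopology (mtop M) U) (top_of_set (\<phi> ` U)) \<phi> h"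
    using hm by (auto simp: homeomorphic_map_maps)
  have hinv: "h y = inv_into U \<phi> y" if "y \<in> \<phi> ` U" for y
    using h that ik tU by (auto simp: homeomorphic_maps_def)
  have "continuous_map (top_of_set (\<phi> ` U)) (subtopology (mtop M) U) (inv_into U \<phi>)"
    using h hinv by (auto simp: homeomorphic_maps_def intro: continuous_map_eq)
  then have c1: "continuous_map (top_of_set (\<phi> ` U)) (mtop M) (inv_into U \<phi>)"
    using continuous_map_in_subtopology by blast
  have "continuous_on V g" using A(5) by (simp add: homeomorphism_def)
  then have "continuous_map (top_of_set V) (top_of_set (\<phi> ` U)) g"
    using gV(1) A(2) by auto
  then have cs: "continuous_map (top_of_set V) (mtop M) \<sigma>"
    unfolding \<sigma>_def using c1 by (rule continuous_map_compose)
  \<comment> \<open>The image of the section is open because it is the preimage of the open set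
    \<open>A\<close> under the chart.\<close>
  have "\<sigma> ` V = {y \<in> topspace (subtopology (mtop M) U). \<phi> y \<in> A}"
  proof safe
    fix y assume "y \<in> V"
    then show "\<sigma> y \<in> topspace (subtopology (mtop M) U)" "\<phi> (\<sigma> y) \<in> A"
      using \<phi>\<sigma> tU gV(1) by auto
  next
    fix y assume "y \<in> topspace (subtopology (mtop M) U)" "\<phi> y \<in> A"
    then have "y \<in> U" "\<phi> y \<in> A" using tU by auto
    moreover then have "y = \<sigma> (k (\<phi> y))" using gV(3) ik by (simp add: \<sigma>_def)
    ultimately show "y \<in> \<sigma> ` V" using gV(4) by blast
  qed
  moreover have "openin (subtopology (mtop M) U) {y \<in> topspace (subtopology (mtop M) U). \<phi> y \<in> A}"
    using hm A(1,2) homeomorphic_imp_continuous_map[OF hm]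
    by (intro openin_continuous_map_preimage) (auto simp: openin_open_eq oA)
  ultimately have op: "openin (mtop M) (\<sigma> ` V)"
    using oU by (metis openin_trans_full)
  have "(\<phi> \<circ> \<sigma>) mholomorphic_on V"
    using mholomorphic_on_cong[OF A(6) A(4)] \<phi>\<sigma>(1) by auto
  then have "holomorphic_section M p V \<sigma>"
    unfolding holomorphic_section_def local_section_def
    using A(4) cs p\<sigma> op U(1) \<phi>\<sigma>(2) by auto
  moreover have "V \<subseteq> \<U>"
    using p\<sigma> \<phi>\<sigma>(2) pU by (metis image_subset_iff subsetI)
  ultimately show thesis using that px \<sigma>x by blast
qed

text \<open>Continuity keeps \<open>\<tau>\<close> inside the open image of \<open>\<sigma>\<close>
  near \<open>y\<close>, and on that image \<open>p\<close> is injective with inverse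
  \<open>\<sigma>\<close>.\<close>

lemma local_section_germ_unique:
  assumes \<sigma>: "holomorphic_section M p V \<sigma>" and \<tau>: "local_section M p W \<tau>"
    and y: "y \<in> W" "\<tau> y \<in> \<sigma> ` V"
  shows "\<forall>\<^sub>F z in nhds y. \<tau> z = \<sigma> z"
proof -
  have "open {z \<in> W. \<tau> z \<in> \<sigma> ` V}"
    using local_section_preimage_open[OF \<tau>] \<sigma> by (simp add: holomorphic_section_def)
  then have "\<forall>\<^sub>F z in nhds y. z \<in> {z \<in> W. \<tau> z \<in> \<sigma> ` V}"
    using y by (intro eventually_nhds_in_open) auto
  then show ?thesis
  proof eventually_elim
    case (elim z)
    then obtain z' where z': "z' \<in> V" "\<tau> z = \<sigma> z'" by blast
    moreover have "p (\<tau> z) = z" using elim \<tau> by (simp add: local_section_def)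
    moreover have "p (\<sigma> z') = z'"
      using \<sigma> z' by (simp add: local_section_def holomorphic_section_def)
    ultimately show ?case by simp
  qed
qed

text \<open>Stated for a map on a part \<open>W\<close> because the known term lives only off
  \<open>\<Sigma>\<close>; \<open>open_submanifold_points\<close> covers maps on the whole
  manifold.\<close>

lemma holomorphic_map_compose_section:
  fixes M :: "('a, 'e::complex_euclidean_space) cmfd" and G :: "'a \<Rightarrow> complex"
  assumes M: "complex_manifold M"
    and G: "holomorphic_map (open_submanifold M W) (open_domain UNIV) G"
    and \<sigma>: "holomorphic_section M p V \<sigma>" and V': "V' \<subseteq> V" "open V'" "\<sigma> ` V' \<subseteq> W"
  shows "(G \<circ> \<sigma>) mholomorphic_on V'"
proof -
  obtain U \<phi> where U: "(U, \<phi>) \<in> atlas M" "\<sigma> ` V \<subseteq> U" "(\<phi> \<circ> \<sigma>) mholomorphic_on V"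
    using \<sigma> by (auto simp: holomorphic_section_def)
  have ch: "holomorphic_chart M U \<phi>" using M U by (auto simp: complex_manifold_def)
  then have "openin (mtop M) U" "homeomorphic_map (subtopology (mtop M) U) (top_of_set (\<phi> ` U)) \<phi>"
    by (auto simp: holomorphic_chart_def)
  then have "inj_on \<phi> U"
    using openin_subset by (fastforce simp: homeomorphic_map_def topspace_subtopology Int_absorb1)
  then have inj: "inj_on \<phi> (U \<inter> W)" by (rule inj_on_subset) auto
  have "(U \<inter> W, \<phi>) \<in> atlas (open_submanifold M W)"
    using U(1) by (force simp: open_submanifold_def)
  then have "(id \<circ> G \<circ> inv_into (U \<inter> W) \<phi>) mholomorphic_on \<phi> ` {x \<in> U \<inter> W. G x \<in> UNIV}"
    using G unfolding holomorphic_map_def open_domain_def by fastforce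
  then have hG: "(G \<circ> inv_into (U \<inter> W) \<phi>) mholomorphic_on \<phi> ` (U \<inter> W)" by (simp add: Int_def)
  have sub: "\<sigma> y \<in> U \<inter> W" if "y \<in> V'" for y using U(2) V' that by auto
  then have "((G \<circ> inv_into (U \<inter> W) \<phi>) \<circ> (\<phi> \<circ> \<sigma>)) mholomorphic_on V'"
    by (intro mholomorphic_on_compose[OF mholomorphic_on_subset[OF U(3) V'(1)] hG]) auto
  then show ?thesis
    by (rule mholomorphic_on_cong[OF _ V'(2)]) (use inv_into_f_f[OF inj sub] in simp)
qed

lemma open_submanifold_points:
  fixes M :: "('a, 'e::complex_euclidean_space) cmfd"
  assumes "complex_manifold M"
  shows "open_submanifold M (points M) = M"
proof -
  have "U \<inter> points M = U" if "(U, \<phi>) \<in> atlas M" for U \<phi>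
    using assms that openin_subset unfolding complex_manifold_def holomorphic_chart_def by fastforce
  then have "(\<lambda>(U, \<phi>). (U \<inter> points M, \<phi>)) ` atlas M = (\<lambda>x. x) ` atlas M"
    by (intro image_cong) auto
  then show ?thesis
    by (simp add: open_submanifold_def)
qed

text \<open>The fibre is compact by properness and covered by open images of sections, so finitely
  many of them suffice. A proper map is closed, so points near \<open>x\<close> have their entire
  fibres inside these images. The images may overlap; they only have to exhaust the
  preimage.\<close>

lemma proper_riemann_domain_evenly_covered:
  fixes M :: "('a, 'e::complex_euclidean_space) cmfd"
  assumes M: "proper_riemann_domain \<U> M p" and x: "x \<in> \<U>"
  obtains V \<G> where "open V" "x \<in> V" "V \<subseteq> \<U>" "finite \<G>"
    "\<forall>\<sigma>\<in>\<G>. \<exists>V'. V \<subseteq> V' \<and> holomorphic_section M p V' \<sigma>"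
    "\<forall>y\<in>points M. p y \<in> V \<longrightarrow> (\<exists>\<sigma>\<in>\<G>. \<sigma> (p y) = y)"
proof -
  have rd: "riemann_domain \<U> M p" and pm: "proper_map (mtop M) (top_of_set \<U>) p"
    using M by (auto simp: proper_riemann_domain_def)
  then have oU: "open \<U>" by (simp add: riemann_domain_def)
  define K where "K = {y \<in> points M. p y = x}"
  have K: "compactin (mtop M) K" using pm x by (simp add: proper_map_def K_def)
  have "\<exists>V \<sigma>. holomorphic_section M p V \<sigma> \<and> x \<in> V \<and> \<sigma> x = y" if "y \<in> K" for y
    using holomorphic_section_exists[OF rd, of y] that by (metis (mono_tags, lifting) K_def mem_Collect_eq)
  then obtain V \<sigma> where V: "\<And>y. y \<in> K \<Longrightarrow> holomorphic_section M p (V y) (\<sigma> y)"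
    "\<And>y. y \<in> K \<Longrightarrow> x \<in> V y" "\<And>y. y \<in> K \<Longrightarrow> \<sigma> y x = y" by metis
  have op: "openin (mtop M) (\<sigma> y ` V y)" "open (V y)" if "y \<in> K" for y
    using V(1)[OF that] by (auto simp: holomorphic_section_def local_section_def)
  have "\<exists>\<F>. finite \<F> \<and> \<F> \<subseteq> (\<lambda>y. \<sigma> y ` V y) ` K \<and> K \<subseteq> \<Union>\<F>"
  proof -
    have "K \<subseteq> \<Union>((\<lambda>y. \<sigma> y ` V y) ` K)"
    proof
      fix y assume y: "y \<in> K"
      then have "\<sigma> y x \<in> \<sigma> y ` V y" using V(2) by blast
      then show "y \<in> \<Union>((\<lambda>y. \<sigma> y ` V y) ` K)" using V(3)[OF y] y by auto
    qed
    then show ?thesis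
      using K op(1) unfolding compactin_def by (metis (no_types, lifting) imageE)
  qed
  then obtain \<F> where \<F>: "finite \<F>" "\<F> \<subseteq> (\<lambda>y. \<sigma> y ` V y) ` K" "K \<subseteq> \<Union>\<F>"
    by blast
  obtain T where T: "T \<subseteq> K" "finite T" "\<F> = (\<lambda>y. \<sigma> y ` V y) ` T"
    using finite_subset_image[OF \<F>(1,2)] by blast
  then have T: "finite T" "T \<subseteq> K" "K \<subseteq> (\<Union>y\<in>T. \<sigma> y ` V y)"
    using \<F>(3) by simp_all
  define N where "N = (\<Union>y\<in>T. \<sigma> y ` V y)"
  have "openin (mtop M) N" unfolding N_def using op T by (intro openin_Union) auto
  then have "closedin (mtop M) (points M - N)" by blast
  then have "closedin (top_of_set \<U>) (p ` (points M - N))"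
    using pm by (simp add: proper_map_def closed_map_def)
  then have "openin (top_of_set \<U>) (\<U> - p ` (points M - N))"
    by (metis openin_diff openin_topspace topspace_euclidean_subtopology)
  then have oN: "open (\<U> - p ` (points M - N))" using oU by (simp add: openin_open_eq)
  \<comment> \<open>Deleting the closed image of what lies outside \<open>N\<close> leaves only
    points whose fibres lie in \<open>N\<close>; the intersection puts \<open>W\<close> in the
    domain of every chosen section.\<close>
  define W where "W = (\<U> - p ` (points M - N)) \<inter> (\<Inter>y\<in>T. V y)"
  show thesis
  proof (rule that[of W "\<sigma> ` T"])
    show "open W" unfolding W_def using oN op T by (intro open_Int open_INT) auto
    show "x \<in> W" unfolding W_def using x V(2) T(2,3) by (auto simp: N_def K_def)
    show "W \<subseteq> \<U>" by (auto simp: W_def)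
    show "finite (\<sigma> ` T)" using T by simp
    show "\<forall>s\<in>\<sigma> ` T. \<exists>V'. W \<subseteq> V' \<and> holomorphic_section M p V' s"
    proof
      fix s assume s: "s \<in> \<sigma> ` T"
      obtain y where "y \<in> T" "s = \<sigma> y" using s by blast
      then show "\<exists>V'. W \<subseteq> V' \<and> holomorphic_section M p V' s"
        using V(1)[of y] T(2) by (intro exI[of _ "V y"]) (auto simp: W_def)
    qed
    show "\<forall>y\<in>points M. p y \<in> W \<longrightarrow> (\<exists>s\<in>\<sigma> ` T. s (p y) = y)"
    proof (intro ballI impI)
      fix y assume "y \<in> points M" "p y \<in> W"
      then have "y \<in> N" by (auto simp: W_def)
      then obtain u v where u: "u \<in> T" "v \<in> V u" "y = \<sigma> u v" by (auto simp: N_def)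
      then have "p y = v"
        using V(1)[of u] T(2) by (auto simp: holomorphic_section_def local_section_def)
      then show "\<exists>s\<in>\<sigma> ` T. s (p y) = y" using u by auto
    qed
  qed
qed

text \<open>Leaves \<open>R\<close> behind: \<open>h t\<close> is \<open>G\<close> read through a
  section around \<open>\<gamma>' t\<close>, and germs at nearby times agree because the lifted arc
  stays for a while in one sheet. The last clause identifies a germ with \<open>G\<close> read
  through any other section, which is how the initial solution is recognised through
  \<open>j\<close>.\<close>

lemma continuation_germs_along_path:
  fixes R :: "('a, complex) cmfd" and G :: "'a \<Rightarrow> complex" and \<gamma> :: "real \<Rightarrow> complex"
  assumes R: "riemann_domain \<U> R \<pi>" and G: "holomorphic_map R (open_domain UNIV) G"
    and \<gamma>': "continuous_map (top_of_set I) (mtop R) \<gamma>'" "\<And>t. t \<in> I \<Longrightarrow> \<pi> (\<gamma>' t) = \<gamma> t"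
    and \<gamma>: "continuous_on I \<gamma>"
  obtains \<epsilon> h where
    "\<forall>t\<in>I. \<epsilon> t > 0" "\<forall>t\<in>I. h t holomorphic_on ball (\<gamma> t) (\<epsilon> t)"
    "\<forall>t\<in>I. h t (\<gamma> t) = G (\<gamma>' t)"
    "\<forall>t\<in>I. \<exists>\<delta>>0. \<forall>s\<in>I. dist s t < \<delta> \<longrightarrow>
        \<gamma> s \<in> ball (\<gamma> t) (\<epsilon> t) \<and> (\<forall>\<^sub>F z in nhds (\<gamma> s). h s z = h t z)"
    "\<forall>t\<in>I. \<forall>U j. local_section R \<pi> U j \<and> \<gamma> t \<in> U \<and> j (\<gamma> t) = \<gamma>' t \<longrightarrow>
        (\<forall>\<^sub>F z in nhds (\<gamma> t). h t z = G (j z))"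
proof -
  have mfd: "complex_manifold R" using R by (simp add: riemann_domain_def)
  have pt: "\<gamma>' t \<in> points R" if "t \<in> I" for t
    using \<gamma>'(1) that by (auto simp: continuous_map_def)
  have "\<exists>V \<sigma>. holomorphic_section R \<pi> V \<sigma> \<and> \<gamma> t \<in> V \<and> \<sigma> (\<gamma> t) = \<gamma>' t" if "t \<in> I" for t
    using holomorphic_section_exists[OF R pt[OF that]] \<gamma>'(2)[OF that] by metis
  then obtain V \<sigma> where V: "\<And>t. t \<in> I \<Longrightarrow> holomorphic_section R \<pi> (V t) (\<sigma> t)"
    "\<And>t. t \<in> I \<Longrightarrow> \<gamma> t \<in> V t" "\<And>t. t \<in> I \<Longrightarrow> \<sigma> t (\<gamma> t) = \<gamma>' t" by metis
  have ls: "local_section R \<pi> (V t) (\<sigma> t)" "openin (mtop R) (\<sigma> t ` V t)" "open (V t)" if "t \<in> I" for t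
    using V(1)[OF that] by (auto simp: holomorphic_section_def local_section_def)
  have "\<exists>e>0. ball (\<gamma> t) e \<subseteq> V t" if "t \<in> I" for t
    using ls(3) V(2) that open_contains_ball by blast
  then obtain \<epsilon> where \<epsilon>: "\<And>t. t \<in> I \<Longrightarrow> \<epsilon> t > 0" "\<And>t. t \<in> I \<Longrightarrow> ball (\<gamma> t) (\<epsilon> t) \<subseteq> V t" by metis
  show thesis
  proof (rule that[of \<epsilon> "\<lambda>t. G \<circ> \<sigma> t"]; intro ballI allI impI)
    fix t assume t: "t \<in> I"
    show "\<epsilon> t > 0" "(G \<circ> \<sigma> t) (\<gamma> t) = G (\<gamma>' t)" using \<epsilon> V t by auto
    have "(G \<circ> \<sigma> t) mholomorphic_on ball (\<gamma> t) (\<epsilon> t)"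
      using G local_section_in_points[OF ls(1)[OF t]] \<epsilon>(2)[OF t]
      by (intro holomorphic_map_compose_section[OF mfd _ V(1)[OF t], where W = "points R"])
        (auto simp: open_submanifold_points[OF mfd])
    then show "(G \<circ> \<sigma> t) holomorphic_on ball (\<gamma> t) (\<epsilon> t)"
      by (simp add: mholomorphic_on_iff_holomorphic_on)
    have mem: "\<gamma>' t \<in> \<sigma> t ` V t" using V(2,3)[OF t] by (metis imageI)
    have "openin (top_of_set I) {s \<in> topspace (top_of_set I). \<gamma>' s \<in> \<sigma> t ` V t}"
      using \<gamma>'(1) ls(2)[OF t] by (rule openin_continuous_map_preimage)
    then obtain T1 where T1: "open T1" "{s \<in> I. \<gamma>' s \<in> \<sigma> t ` V t} = I \<inter> T1"
      by (auto simp: openin_open)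
    obtain T2 where T2: "open T2" "I \<inter> \<gamma> -` ball (\<gamma> t) (\<epsilon> t) = I \<inter> T2"
      using \<gamma> by (metis continuous_on_open_invariant open_ball inf_commute)
    \<comment> \<open>\<open>T1\<close> keeps the lifted arc in the sheet of
      \<open>\<sigma> t\<close>, and \<open>T2\<close> keeps \<open>\<gamma>\<close> in the chosen
      disc about \<open>\<gamma> t\<close>.\<close>
    have "t \<in> T1 \<inter> T2" using T1(2) T2(2) mem t \<epsilon>(1)[OF t] by (auto simp: set_eq_iff)
    then obtain \<delta> where \<delta>: "\<delta> > 0" "ball t \<delta> \<subseteq> T1 \<inter> T2"
      using T1(1) T2(1) open_contains_ball by blast
    show "\<exists>\<delta>>0. \<forall>s\<in>I. dist s t < \<delta> \<longrightarrow> \<gamma> s \<in> ball (\<gamma> t) (\<epsilon> t) \<and>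
        (\<forall>\<^sub>F z in nhds (\<gamma> s). (G \<circ> \<sigma> s) z = (G \<circ> \<sigma> t) z)"
    proof (intro exI[of _ \<delta>] conjI ballI impI \<delta>(1))
      fix s assume s: "s \<in> I" "dist s t < \<delta>"
      then have "s \<in> I \<inter> T1" "s \<in> I \<inter> T2" using \<delta>(2) by (auto simp: dist_commute)
      then have st: "\<gamma>' s \<in> \<sigma> t ` V t" "\<gamma> s \<in> ball (\<gamma> t) (\<epsilon> t)"
        using T1(2) T2(2) by blast+
      then show "\<gamma> s \<in> ball (\<gamma> t) (\<epsilon> t)" by simp
      have "\<forall>\<^sub>F z in nhds (\<gamma> s). \<sigma> s z = \<sigma> t z"
        using st V[OF s(1)] by (intro local_section_germ_unique[OF V(1)[OF t] ls(1)[OF s(1)]]) auto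
      then show "\<forall>\<^sub>F z in nhds (\<gamma> s). (G \<circ> \<sigma> s) z = (G \<circ> \<sigma> t) z"
        by eventually_elim simp
    qed
    fix U j assume "local_section R \<pi> U j \<and> \<gamma> t \<in> U \<and> j (\<gamma> t) = \<gamma>' t"
    then have j: "local_section R \<pi> U j" "\<gamma> t \<in> U" "j (\<gamma> t) = \<gamma>' t" by auto
    have "\<forall>\<^sub>F z in nhds (\<gamma> t). j z = \<sigma> t z"
      using local_section_germ_unique[OF V(1)[OF t] j(1,2)] j(3) mem by simp
    then show "\<forall>\<^sub>F z in nhds (\<gamma> t). (G \<circ> \<sigma> t) z = G (j z)"
      by eventually_elim simp
  qed
qed

section \<open>Holomorphic ordinary differential equations\<close>

text \<open>Gronwall in its simplest form: on a disc whose radius satisfies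
  \<open>L * r \<le> 1/2\<close>, the maximum of \<open>cmod (d z)\<close> is at most half of
  itself.\<close>

lemma eventually_eq_zero_of_derivative_bound:
  fixes d :: "complex \<Rightarrow> complex"
  assumes d: "\<forall>\<^sub>F z in nhds a. (d has_field_derivative d' z) (at z) \<and> cmod (d' z) \<le> L * cmod (d z)"
    and L: "L > 0" and a: "d a = 0"
  shows "\<forall>\<^sub>F z in nhds a. d z = 0"
proof -
  obtain s where s: "s > 0" "\<And>z. z \<in> ball a s \<Longrightarrow> (d has_field_derivative d' z) (at z)"
    "\<And>z. z \<in> ball a s \<Longrightarrow> cmod (d' z) \<le> L * cmod (d z)"
    using d by (auto simp: eventually_nhds_metric dist_commute)
  define r where "r = min (s/2) (1 / (2 * L))"
  have r: "r > 0" "r < s" "L * r \<le> 1/2"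
    using s(1) L by (auto simp: r_def min_def field_simps)
  have sub: "cball a r \<subseteq> ball a s" using r by auto
  have "continuous_on (cball a r) (\<lambda>z. cmod (d z))"
    using DERIV_isCont[OF s(2)] sub
    by (intro continuous_on_norm continuous_at_imp_continuous_on) auto
  then obtain m where m: "m \<in> cball a r" "\<And>z. z \<in> cball a r \<Longrightarrow> cmod (d z) \<le> cmod (d m)"
    using continuous_attains_sup[of "cball a r" "\<lambda>z. cmod (d z)"] r(1) by fastforce
  have "cmod (d m - d a) \<le> (L * cmod (d m)) * cmod (m - a)"
  proof (rule field_differentiable_bound[where S = "cball a r" and f' = d'])
    show "(d has_field_derivative d' z) (at z within cball a r)" if "z \<in> cball a r" for z
      using s(2) sub that has_field_derivative_at_within by blast
    show "cmod (d' z) \<le> L * cmod (d m)" if "z \<in> cball a r" for z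
      using order_trans[OF s(3)[of z] mult_left_mono[OF m(2)[OF that], of L]] sub that L by auto
  qed (use m r in auto)
  also have "\<dots> \<le> (L * cmod (d m)) * r"
    using m(1) L by (intro mult_left_mono) (auto simp: dist_norm norm_minus_commute)
  also have "\<dots> = (L * r) * cmod (d m)" by simp
  also have "\<dots> \<le> 1/2 * cmod (d m)" using r(3) by (intro mult_right_mono) auto
  finally have "d m = 0" using a by simp
  then have "d z = 0" if "z \<in> ball a r" for z
    using m(2)[of z] that by simp
  then show ?thesis
    using r(1) eventually_nhds_in_open[of "ball a r" a] by (auto elim!: eventually_mono)
qed

text \<open>Cauchy's estimate on discs of radius \<open>\<delta>/2\<close> about points of
  \<open>cball v0 \<delta>\<close> bounds the derivative by \<open>M / (\<delta>/2)\<close>; the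
  doubled radius in the hypotheses leaves room for these discs.\<close>

lemma holomorphic_lipschitz_snd:
  fixes \<Phi> :: "complex \<times> complex \<Rightarrow> complex"
  assumes \<Phi>: "\<Phi> mholomorphic_on V" and z: "\<And>y. y \<in> cball v0 (2 * \<delta>) \<Longrightarrow> (z, y) \<in> V"
    and M: "\<And>y. y \<in> cball v0 (2 * \<delta>) \<Longrightarrow> cmod (\<Phi> (z, y)) \<le> M" and \<delta>: "\<delta> > 0"
    and ab: "a \<in> cball v0 \<delta>" "b \<in> cball v0 \<delta>"
  shows "cmod (\<Phi> (z, a) - \<Phi> (z, b)) \<le> 2 * M / \<delta> * cmod (a - b)"
proof -
  define k where "k = (\<lambda>y. \<Phi> (z, y))"
  have line: "(z, 0) + scaleC c (0, 1) = (z, c)" for c :: complex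
    by (simp add: scaleC_prod_def scaleC_complex_def)
  have "(\<lambda>c. \<Phi> ((z, 0) + scaleC c (0, 1))) holomorphic_on ball v0 (2 * \<delta>)"
    by (rule holomorphic_on_line(1)[OF \<Phi>]) (use z line in auto)
  then have k: "k holomorphic_on ball v0 (2 * \<delta>)" by (simp add: k_def line)
  have "cmod (k a - k b) \<le> (2 * M / \<delta>) * cmod (a - b)"
  proof (rule field_differentiable_bound[where S = "cball v0 \<delta>" and f' = "deriv k"])
    fix y assume y: "y \<in> cball v0 \<delta>"
    then have "y \<in> ball v0 (2 * \<delta>)" using \<delta> by auto
    then show "(k has_field_derivative deriv k y) (at y within cball v0 \<delta>)"
      using k by (meson has_field_derivative_at_within holomorphic_derivI open_ball)
    have sub: "cball y (\<delta>/2) \<subseteq> ball v0 (2 * \<delta>)"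
    proof
      fix x assume "x \<in> cball y (\<delta>/2)"
      then show "x \<in> ball v0 (2 * \<delta>)" using y \<delta> dist_triangle[of v0 x y] by auto
    qed
    have "cmod ((deriv ^^ 1) k y) \<le> fact 1 * M / (\<delta>/2) ^ 1"
    proof (rule Cauchy_inequality)
      show "k holomorphic_on ball y (\<delta>/2)"
        using k sub ball_subset_cball holomorphic_on_subset by (metis (no_types, lifting) subset_trans)
      show "continuous_on (cball y (\<delta>/2)) k"
        using k sub holomorphic_on_imp_continuous_on holomorphic_on_subset by blast
      fix x assume "cmod (y - x) = \<delta>/2"
      then have "x \<in> cball y (\<delta>/2)" by (simp add: dist_norm)
      then have "x \<in> cball v0 (2 * \<delta>)" using sub by auto
      then show "cmod (k x) \<le> M" using M by (simp add: k_def)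
    qed (use \<delta> in auto)
    then show "cmod (deriv k y) \<le> 2 * M / \<delta>" by (simp add: mult.commute)
  qed (use ab in auto)
  then show ?thesis by (simp add: k_def)
qed

text \<open>Picard iteration on a disc fixed beforehand: neither its centre \<open>x1\<close> nor
  its radius depends on the initial point and value, so a solution that starts just before the end
  of the arc is sure to reach it. The conclusion compares with a given local solution
  \<open>h\<close>, because a germ already at hand has to be recognised.\<close>

lemma uniform_local_solution:
  fixes \<Phi> :: "complex \<times> complex \<Rightarrow> complex"
  assumes \<Phi>: "\<Phi> mholomorphic_on V" and V: "open V" "(x1, v0) \<in> V"
  obtains \<rho> where "\<rho> > 0" "\<And>z1 w1. z1 \<in> ball x1 \<rho> \<Longrightarrow> w1 \<in> ball v0 \<rho> \<Longrightarrow>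
    \<exists>u. u holomorphic_on ball x1 \<rho> \<and>
      (\<forall>h. h z1 = w1 \<and> (\<forall>\<^sub>F z in nhds z1. (h has_field_derivative \<Phi> (z, h z)) (at z)) \<longrightarrow>
         (\<forall>\<^sub>F z in nhds z1. h z = u z))"
proof -
  obtain A B where AB: "open A" "open B" "(x1, v0) \<in> A \<times> B" "A \<times> B \<subseteq> V"
    using V open_prod_elim by blast
  obtain e1 where e1: "e1 > 0" "cball x1 e1 \<subseteq> A"
    using AB open_contains_cball by (metis SigmaD1)
  obtain e2 where e2: "e2 > 0" "cball v0 e2 \<subseteq> B"
    using AB open_contains_cball by (metis SigmaD2)
  define \<delta> where "\<delta> = min e1 e2 / 2"
  define K where "K = cball x1 (2 * \<delta>) \<times> cball v0 (2 * \<delta>)"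
  have \<delta>: "\<delta> > 0" using e1 e2 by (simp add: \<delta>_def)
  have "cball x1 (2 * \<delta>) \<subseteq> A" "cball v0 (2 * \<delta>) \<subseteq> B"
    using e1(2) e2(2) by (auto simp: \<delta>_def)
  then have KV: "K \<subseteq> V" using AB(4) unfolding K_def by blast
  have "compact K" unfolding K_def by (intro compact_Times compact_cball)
  then have "compact (\<Phi> ` K)"
    using KV continuous_on_subset[OF mholomorphic_on_imp_continuous_on[OF \<Phi>]] compact_continuous_image by blast
  then obtain M where M: "M > 0" "\<And>x. x \<in> K \<Longrightarrow> cmod (\<Phi> x) \<le> M"
    using compact_imp_bounded bounded_pos by (metis imageI)
  define L where "L = 2 * M / \<delta>"
  have L: "L > 0" using M \<delta> by (simp add: L_def)
  have Lip: "cmod (\<Phi> (z, a) - \<Phi> (z, b)) \<le> L * cmod (a - b)"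
    if "z \<in> cball x1 (2 * \<delta>)" "a \<in> cball v0 \<delta>" "b \<in> cball v0 \<delta>" for z a b
    unfolding L_def using that KV M(2) \<delta>
    by (intro holomorphic_lipschitz_snd[OF \<Phi>]) (auto simp: K_def subset_iff)
  \<comment> \<open>Points of the disc lie within \<open>2 * \<rho>\<close> of \<open>z1\<close>. So
    \<open>2 * \<rho> * M \<le> \<delta>/4\<close> keeps iterates within \<open>\<delta>/4\<close>
    of \<open>w1\<close>, itself within \<open>\<delta>/2\<close> of \<open>v0\<close>; with
    \<open>L = 2 * M / \<delta>\<close> the same bound yields the contraction factor
    \<open>1/2\<close>.\<close>
  define \<rho> where "\<rho> = min (\<delta>/2) (\<delta> / (8 * M))"
  have \<rho>: "\<rho> > 0" "\<rho> \<le> \<delta>/2" "\<rho> \<le> \<delta> / (8 * M)" using \<delta> M(1) by (auto simp: \<rho>_def)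
  have \<rho>M: "2 * \<rho> * M \<le> \<delta>/4" using \<rho>(3) M(1) by (simp add: field_simps)
  have \<rho>L: "L * (2 * \<rho>) \<le> 1/2" using \<rho>M \<delta> by (simp add: L_def field_simps)
  define B where "B = ball x1 \<rho>"
  have B: "open B" "convex B" by (auto simp: B_def)
  have Bsub: "B \<subseteq> cball x1 (2 * \<delta>)" using \<rho> \<delta> by (auto simp: B_def)
  show thesis
  proof (rule that[OF \<rho>(1)])
    fix z1 w1 assume z1: "z1 \<in> ball x1 \<rho>" and w1: "w1 \<in> ball v0 \<rho>"
    have z1B: "z1 \<in> B" using z1 by (simp add: B_def)
    have zz1: "cmod (z - z1) \<le> 2 * \<rho>" if "z \<in> B" for z
      using that z1 dist_triangle[of z z1 x1] by (simp add: B_def dist_commute dist_norm norm_minus_commute)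
    \<comment> \<open>The space on which the Picard operator acts: graphs that stay where
      \<open>\<Phi>\<close> is bounded and Lipschitz. Convexity of \<open>B\<close> provides the
      primitive that replaces the integral.\<close>
    define adm where "adm u \<longleftrightarrow> u holomorphic_on B \<and> u ` B \<subseteq> cball v0 \<delta>" for u
    have admK: "(z, u z) \<in> K" "u z \<in> cball v0 \<delta>" if "adm u" "z \<in> B" for u z
      using that Bsub \<delta> by (auto simp: adm_def K_def)
    have step: "\<exists>u'. adm u' \<and> u' z1 = w1 \<and> (\<forall>z\<in>B. (u' has_field_derivative \<Phi> (z, u z)) (at z))"
      if u: "adm u" for u
    proof -
      have "(\<lambda>z. \<Phi> (z, u z)) holomorphic_on B"
        using u admK[OF u] KV B by (intro holomorphic_graph_compose[OF \<Phi>]) (auto simp: adm_def)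
      then obtain g where g: "\<And>z. z \<in> B \<Longrightarrow> (g has_field_derivative \<Phi> (z, u z)) (at z within B)"
        using holomorphic_convex_primitive'[OF B(2,1)] by blast
      define u' where "u' = (\<lambda>z. g z - g z1 + w1)"
      have der: "(u' has_field_derivative \<Phi> (z, u z)) (at z)" if "z \<in> B" for z
        using g[OF that] that B(1) unfolding u'_def
        by (auto intro!: derivative_eq_intros simp: at_within_open[OF that B(1)])
      have u1: "u' z1 = w1" by (simp add: u'_def)
      have "u' z \<in> cball v0 \<delta>" if z: "z \<in> B" for z
      proof -
        have "cmod (u' z - u' z1) \<le> M * cmod (z - z1)"
          using der M(2) admK(1)[OF u] z z1B
          by (intro field_differentiable_bound[OF B(2), where f' = "\<lambda>z. \<Phi> (z, u z)"])
            (auto intro: has_field_derivative_at_within)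
        also have "\<dots> \<le> M * (2 * \<rho>)" using zz1[OF z] M(1) by (intro mult_left_mono) auto
        also have "\<dots> \<le> \<delta>/4" using \<rho>M by (simp add: mult_ac)
        finally have "dist w1 (u' z) \<le> \<delta>/4" by (simp add: u1 dist_norm norm_minus_commute)
        then show ?thesis using w1 \<rho>(2) dist_triangle[of v0 "u' z" w1] \<delta> by auto
      qed
      moreover have "u' holomorphic_on B" using der B(1) holomorphic_on_open by blast
      ultimately show ?thesis using der u1 by (intro exI[of _ u']) (auto simp: adm_def)
    qed
    then obtain T where T: "\<And>u. adm u \<Longrightarrow> adm (T u)" "\<And>u. adm u \<Longrightarrow> T u z1 = w1"
      "\<And>u z. adm u \<Longrightarrow> z \<in> B \<Longrightarrow> (T u has_field_derivative \<Phi> (z, u z)) (at z)"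
      by metis
    have contr: "cmod (T a z - T b z) \<le> C / 2"
      if a: "adm a" and b: "adm b" and C: "\<And>z. z \<in> B \<Longrightarrow> cmod (a z - b z) \<le> C" and z: "z \<in> B"
      for a b C z
    proof -
      have C0: "0 \<le> C" using C[OF z] norm_ge_zero order_trans by blast
      have "cmod ((T a z - T b z) - (T a z1 - T b z1)) \<le> (L * C) * cmod (z - z1)"
      proof (rule field_differentiable_bound[OF B(2), where f' = "\<lambda>z. \<Phi> (z, a z) - \<Phi> (z, b z)"])
        fix y assume y: "y \<in> B"
        show "((\<lambda>z. T a z - T b z) has_field_derivative \<Phi> (y, a y) - \<Phi> (y, b y)) (at y within B)"
          using T(3)[OF a y] T(3)[OF b y]
          by (intro has_field_derivative_at_within[OF DERIV_diff])
        have "cmod (\<Phi> (y, a y) - \<Phi> (y, b y)) \<le> L * cmod (a y - b y)"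
          using Lip admK(2)[OF a y] admK(2)[OF b y] Bsub y by blast
        also have "\<dots> \<le> L * C" using C[OF y] L by (intro mult_left_mono) auto
        finally show "cmod (\<Phi> (y, a y) - \<Phi> (y, b y)) \<le> L * C" .
      qed (use z z1B in auto)
      also have "\<dots> \<le> (L * C) * (2 * \<rho>)" using zz1[OF z] L C0 by (intro mult_left_mono) auto
      also have "\<dots> = (L * (2 * \<rho>)) * C" by simp
      also have "\<dots> \<le> 1/2 * C" using \<rho>L C0 by (intro mult_right_mono)
      finally show ?thesis using T(2)[OF a] T(2)[OF b] by simp
    qed
    define u where "u n = (T ^^ n) (\<lambda>_. w1)" for n
    have u0: "u 0 = (\<lambda>_. w1)" and uS: "\<And>n. u (Suc n) = T (u n)" by (simp_all add: u_def)
    have adm: "adm (u n)" for n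
    proof (induction n)
      case 0
      show ?case using w1 \<rho> \<delta> by (auto simp: u0 adm_def)
    qed (simp add: uS T(1))
    \<comment> \<open>Both functions take values in a disc of radius \<open>\<delta>\<close>, whence
      the initial \<open>2 * \<delta>\<close>; each further step halves the bound.\<close>
    have diff: "cmod (u (Suc n) z - u n z) \<le> 2 * \<delta> * (1/2) ^ n" if "z \<in> B" for n z
      using that
    proof (induction n arbitrary: z)
      case 0
      have "dist (u 1 z) (u 0 z) \<le> \<delta> + \<delta>"
        using admK(2)[OF adm 0] dist_triangle2[of "u 1 z" "u 0 z" v0]
        by (smt (verit) dist_commute mem_cball)
      then show ?case by (simp add: dist_norm)
    next
      case (Suc n)
      from contr[OF adm[of "Suc n"] adm[of n] Suc.IH Suc.prems] show ?case by (simp add: uS)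
    qed
    have "summable (\<lambda>n. 2 * \<delta> * (1/2::real) ^ n)" by (intro summable_mult summable_geometric) simp
    from Weierstrass_m_test[where A = B and f = "\<lambda>n z. u (Suc n) z - u n z", OF diff this]
    obtain g where "uniform_limit B (\<lambda>n z. \<Sum>i<n. u (Suc i) z - u i z) g sequentially" by blast
    then have "uniform_limit B (\<lambda>n z. u n z - w1) g sequentially"
      by (simp add: sum_lessThan_telescope[where f = "\<lambda>i. u i z" for z] u0)
    from uniform_limit_add[OF this uniform_limit_const[where c = "\<lambda>_. w1"]]
    have ul: "uniform_limit B u (\<lambda>z. g z + w1) sequentially" by simp
    define v where "v z = g z + w1" for z
    \<comment> \<open>The shift by one matters: \<open>u (Suc n)\<close> has the known derivative
      \<open>\<Phi> (z, u n z)\<close>, while the constant \<open>u 0\<close> is only the seed of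
      the iteration.\<close>
    have "filterlim (\<lambda>n. u (Suc n)) (uniformly_on B v) sequentially"
      using filterlim_compose[OF ul filterlim_Suc] by (simp add: v_def[abs_def] o_def)
    then have ulS: "uniform_limit B (\<lambda>n. u (Suc n)) v sequentially" .
    have lim: "(\<lambda>n. u n z) \<longlonglongrightarrow> v z" if "z \<in> B" for z
      using tendsto_uniform_limitI[OF ul that] by (simp add: v_def)
    have "\<exists>d>0. cball z d \<subseteq> B \<and> uniform_limit (cball z d) (\<lambda>n. u (Suc n)) v sequentially" if "z \<in> B" for z
      using open_contains_cball B(1) that ulS uniform_limit_on_subset by meson
    from has_complex_derivative_uniform_sequence[OF B(1) _ this, where f' = "\<lambda>n z. \<Phi> (z, u n z)"]
    obtain v' where v': "\<And>z. z \<in> B \<Longrightarrow> (v has_field_derivative v' z) (at z)"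
      "\<And>z. z \<in> B \<Longrightarrow> (\<lambda>n. \<Phi> (z, u n z)) \<longlonglongrightarrow> v' z"
      using T(3)[OF adm] by (auto simp: uS)
    have vb: "v z \<in> cball v0 \<delta>" if "z \<in> B" for z
      using admK(2)[OF adm that] by (intro closed_sequentially[OF closed_cball _ lim[OF that]]) auto
    have v: "(v has_field_derivative \<Phi> (z, v z)) (at z)" if z: "z \<in> B" for z
    proof -
      have "(z, v z) \<in> V" using vb[OF z] Bsub z KV \<delta> by (auto simp: K_def)
      then have "isCont \<Phi> (z, v z)"
        using mholomorphic_on_imp_continuous_on[OF \<Phi>] V(1) continuous_on_eq_continuous_at by blast
      then have "(\<lambda>n. \<Phi> (z, u n z)) \<longlonglongrightarrow> \<Phi> (z, v z)"
        by (rule isCont_tendsto_compose) (intro tendsto_intros lim z)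
      then have "v' z = \<Phi> (z, v z)" using v'(2)[OF z] LIMSEQ_unique by blast
      then show ?thesis using v'(1)[OF z] by simp
    qed
    have "(\<lambda>n. u (Suc n) z1) \<longlonglongrightarrow> v z1" using lim[OF z1B] by (rule LIMSEQ_Suc)
    then have v1: "v z1 = w1" using T(2)[OF adm] by (simp add: uS LIMSEQ_const_iff)
    show "\<exists>u. u holomorphic_on ball x1 \<rho> \<and>
      (\<forall>h. h z1 = w1 \<and> (\<forall>\<^sub>F z in nhds z1. (h has_field_derivative \<Phi> (z, h z)) (at z)) \<longrightarrow>
         (\<forall>\<^sub>F z in nhds z1. h z = u z))"
    proof (intro exI[of _ v] conjI allI impI)
      show "v holomorphic_on ball x1 \<rho>" using v B(1) holomorphic_on_open B_def by blast
      fix h assume "h z1 = w1 \<and> (\<forall>\<^sub>F z in nhds z1. (h has_field_derivative \<Phi> (z, h z)) (at z))"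
      then have h1: "h z1 = w1" and h: "\<forall>\<^sub>F z in nhds z1. (h has_field_derivative \<Phi> (z, h z)) (at z)"
        by auto
      \<comment> \<open>\<open>h\<close> is first confined to the disc about \<open>v0\<close>,
        because the Lipschitz bound is available only there.\<close>
      have "isCont h z1" using eventually_nhds_x_imp_x[OF h] DERIV_isCont by blast
      moreover have "h z1 \<in> ball v0 \<delta>" using w1 \<rho>(2) \<delta> by (auto simp: h1)
      ultimately have hb: "\<forall>\<^sub>F z in nhds z1. h z \<in> ball v0 \<delta>"
        by (metis eventually_nhds_in_open isCont_def open_ball tendsto_at_iff_tendsto_nhds topological_tendstoD)
      have zb: "\<forall>\<^sub>F z in nhds z1. z \<in> B" using B(1) z1B by (rule eventually_nhds_in_open)
      have "\<forall>\<^sub>F z in nhds z1. ((\<lambda>z. h z - v z) has_field_derivative \<Phi> (z, h z) - \<Phi> (z, v z)) (at z) \<and>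
          cmod (\<Phi> (z, h z) - \<Phi> (z, v z)) \<le> L * cmod (h z - v z)"
        using h hb zb
      proof eventually_elim
        case (elim z)
        then show ?case using Lip[of z "h z" "v z"] Bsub vb[of z] v[of z]
          by (auto intro: DERIV_diff)
      qed
      from eventually_eq_zero_of_derivative_bound[OF this L]
      show "\<forall>\<^sub>F z in nhds z1. h z = v z" using h1 v1 by simp
    qed
  qed
qed

section \<open>Cluster points and continuation along a path\<close>

text \<open>Failure of divergence gives a finite cluster point \<open>b\<close>, which may lie in
  \<open>Z\<close>. Failure of convergence to \<open>b\<close> forces excursions to distance
  \<open>e\<close>, so every smaller circle about \<open>b\<close> is crossed at times arbitrarily
  close to \<open>1\<close>. The radius is still free, and compactness of the circle gives
  \<open>v0\<close>.\<close>

lemma no_limit_imp_cluster_point: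
  fixes f :: "real \<Rightarrow> complex"
  assumes f: "continuous_on {a..<1} f" and a: "a < 1" and Z: "countable Z"
    and fin: "\<nexists>l. (f \<longlongrightarrow> l) (at_left 1)" and inf: "\<not> filterlim f at_infinity (at_left 1)"
  obtains v0 where "v0 \<notin> Z" "\<And>\<rho> t. \<rho> > 0 \<Longrightarrow> t < 1 \<Longrightarrow> \<exists>s. t < s \<and> s < 1 \<and> dist (f s) v0 < \<rho>"
proof -
  have cluster: "\<exists>v\<in>K. \<forall>\<rho>>0. \<forall>t<1. \<exists>s. t < s \<and> s < 1 \<and> dist (f s) v < \<rho>"
    if K: "compact K" and fr: "\<And>t. t < 1 \<Longrightarrow> \<exists>s. t < s \<and> s < 1 \<and> f s \<in> K" for K
  proof -
    have "\<exists>s. 1 - inverse (real (Suc n)) < s \<and> s < 1 \<and> f s \<in> K" for n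
      by (intro fr) simp
    then obtain s where s: "\<And>n. 1 - inverse (real (Suc n)) < s n" "\<And>n. s n < 1" "\<And>n. f (s n) \<in> K"
      by metis
    then obtain v r where v: "v \<in> K" "strict_mono r" "((\<lambda>n. f (s n)) \<circ> r) \<longlonglongrightarrow> v"
      using K unfolding compact_def by (metis (no_types, lifting))
    have "s \<longlonglongrightarrow> 1"
    proof (rule tendsto_sandwich[OF _ _ _ tendsto_const])
      have "(\<lambda>n. 1 - inverse (real (Suc n))) \<longlonglongrightarrow> 1 - 0"
        by (intro tendsto_intros LIMSEQ_inverse_real_of_nat)
      then show "(\<lambda>n. 1 - inverse (real (Suc n))) \<longlonglongrightarrow> 1" by simp
    qed (use s(1,2) less_imp_le in \<open>blast intro: always_eventually\<close>)+
    then have sr: "(\<lambda>n. s (r n)) \<longlonglongrightarrow> 1"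
      using LIMSEQ_subseq_LIMSEQ[OF _ v(2)] by (auto simp: o_def)
    show ?thesis
    proof (intro bexI[OF _ v(1)] allI impI)
      fix \<rho> t :: real assume \<rho>: "\<rho> > 0" and t: "t < 1"
      have "\<forall>\<^sub>F n in sequentially. t < s (r n)" using sr t by (rule order_tendstoD)
      moreover have "\<forall>\<^sub>F n in sequentially. dist (f (s (r n))) v < \<rho>"
        using tendstoD[OF v(3) \<rho>] by simp
      ultimately have "\<forall>\<^sub>F n in sequentially. t < s (r n) \<and> dist (f (s (r n))) v < \<rho>"
        by eventually_elim simp
      then show "\<exists>s. t < s \<and> s < 1 \<and> dist (f s) v < \<rho>"
        using s(2) by (auto simp: eventually_sequentially)
    qed
  qed
  have freq: "\<exists>s. t < s \<and> s < 1 \<and> P s" if "\<not> (\<forall>\<^sub>F s in at_left 1. \<not> P s)" "t < 1" for P and t :: real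
    using that unfolding eventually_at_left_field by blast
  obtain K where "\<not> (\<forall>\<^sub>F s in at_left 1. K < norm (f s))"
    using inf unfolding filterlim_at_infinity_conv_norm_at_top filterlim_at_top_dense by blast
  then have "\<not> (\<forall>\<^sub>F s in at_left 1. \<not> f s \<in> cball 0 K)"
    by (simp add: not_le)
  from cluster[OF compact_cball freq[OF this]] obtain b where b:
    "\<And>\<rho> t. \<rho> > 0 \<Longrightarrow> t < 1 \<Longrightarrow> \<exists>s. t < s \<and> s < 1 \<and> dist (f s) b < \<rho>"
    by blast
  have "\<not> (f \<longlongrightarrow> b) (at_left 1)" using fin by blast
  then obtain e where e: "e > 0" "\<not> (\<forall>\<^sub>F s in at_left 1. dist (f s) b < e)"
    by (auto simp: tendsto_iff)
  \<comment> \<open>Each point of \<open>Z\<close> spoils a single radius.\<close>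
  have "uncountable ({0<..<e} - dist b ` Z)"
    using e(1) Z by (intro uncountable_minus_countable uncountable_open_interval[THEN iffD2]) auto
  then obtain \<rho> where \<rho>: "0 < \<rho>" "\<rho> < e" "\<rho> \<notin> dist b ` Z"
    by (metis DiffE countable_empty ex_in_conv greaterThanLessThan_iff)
  have "\<exists>s. t < s \<and> s < 1 \<and> f s \<in> sphere b \<rho>" if "t < 1" for t
  proof -
    \<comment> \<open>Keeps the crossing inside the interval where \<open>f\<close> is
      continuous.\<close>
    define t' where "t' = max a t"
    have t': "t' < 1" "a \<le> t'" "t \<le> t'" using that a by (auto simp: t'_def)
    obtain s1 where s1: "t' < s1" "s1 < 1" "dist (f s1) b < \<rho>" using b[OF \<rho>(1) t'(1)] by blast
    obtain s2 where s2: "s1 < s2" "s2 < 1" "e \<le> dist (f s2) b"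
      using freq[of "\<lambda>s. e \<le> dist (f s) b" s1] e(2) s1(2) by (auto simp: not_le)
    have "continuous_on {s1..s2} (\<lambda>s. dist (f s) b)"
      using s1 s2 t' by (intro continuous_on_dist continuous_on_const continuous_on_subset[OF f]) auto
    then obtain s where "s1 \<le> s" "s \<le> s2" "dist (f s) b = \<rho>"
      using IVT'[of "\<lambda>s. dist (f s) b" s1 \<rho> s2] s1(3) s2(1,3) \<rho>(2) by force
    then show ?thesis using s1 s2 t' by (intro exI[of _ s]) (auto simp: dist_commute)
  qed
  note cluster[OF compact_sphere this]
  then obtain v0 where "v0 \<in> sphere b \<rho>"
    "\<forall>\<rho>>0. \<forall>t<1. \<exists>s. t < s \<and> s < 1 \<and> dist (f s) v0 < \<rho>" by blast
  moreover then have "v0 \<notin> Z" using \<rho>(3) by auto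
  ultimately show thesis using that by blast
qed

text \<open>Two points of a small neighbourhood are compared through its centre \<open>t\<close>, so
  equivalence with the centre alone suffices; connectedness finishes.\<close>

lemma locally_constant_on_interval:
  fixes a b c :: real
  assumes loc: "\<And>t. t \<in> {a..<b} \<Longrightarrow> \<exists>\<delta>>0. \<forall>s\<in>{a..<b}. dist s t < \<delta> \<longrightarrow> (P s \<longleftrightarrow> P t)"
    and c: "c \<in> {a..<b}" "P c" and d: "d \<in> {a..<b}"
  shows "P d"
proof (rule connected_induction_simple[of "{a..<b}" c d])
  fix t assume t: "t \<in> {a..<b}"
  then obtain \<delta> where \<delta>: "\<delta> > 0" "\<forall>s\<in>{a..<b}. dist s t < \<delta> \<longrightarrow> (P s \<longleftrightarrow> P t)"
    using loc by blast
  show "\<exists>T. openin (top_of_set {a..<b}) T \<and> t \<in> T \<and> (\<forall>x\<in>T. \<forall>y\<in>T. P x \<longrightarrow> P y)"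
  proof (intro exI[of _ "{a..<b} \<inter> ball t \<delta>"] conjI ballI impI)
    show "openin (top_of_set {a..<b}) ({a..<b} \<inter> ball t \<delta>)" by (simp add: openin_open_Int)
    show "t \<in> {a..<b} \<inter> ball t \<delta>" using t \<delta>(1) by simp
    fix x y assume "x \<in> {a..<b} \<inter> ball t \<delta>" "y \<in> {a..<b} \<inter> ball t \<delta>" "P x"
    then show "P y" using \<delta>(2) by (metis IntD1 IntD2 dist_commute mem_ball)
  qed
qed (use c d in auto)

text \<open>\<open>h t\<close> is the branch of the continued function near \<open>\<gamma> t\<close>; its values elsewhere are junk.\<close>

locale path_continuation =
  fixes \<gamma> :: "real \<Rightarrow> complex" and \<epsilon> :: "real \<Rightarrow> real" and h :: "real \<Rightarrow> complex \<Rightarrow> complex"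
  assumes pos: "t \<in> {0..<1} \<Longrightarrow> \<epsilon> t > 0"
    and hol: "t \<in> {0..<1} \<Longrightarrow> h t holomorphic_on ball (\<gamma> t) (\<epsilon> t)"
    and cont: "t \<in> {0..<1} \<Longrightarrow> \<exists>\<delta>>0. \<forall>s\<in>{0..<1}. dist s t < \<delta> \<longrightarrow>
        \<gamma> s \<in> ball (\<gamma> t) (\<epsilon> t) \<and> (\<forall>\<^sub>F z in nhds (\<gamma> s). h s z = h t z)"
begin

text \<open>The hypothesis \<open>dense\<close> is the identity theorem in disguise: one point with property \<open>P\<close>
  spreads over the whole disc.\<close>

lemma propagate:
  assumes cong: "\<And>f g z. P f z \<Longrightarrow> \<forall>\<^sub>F y in nhds z. f y = g y \<Longrightarrow> P g z"
    and dense: "\<And>f b e z N. f holomorphic_on ball b e \<Longrightarrow> z \<in> ball b e \<Longrightarrow> P f z \<Longrightarrow>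
        open N \<Longrightarrow> N \<subseteq> ball b e \<Longrightarrow> N \<noteq> {} \<Longrightarrow> \<exists>y\<in>N. P f y"
    and c: "c \<in> {0..<1}" "z \<in> ball (\<gamma> c) (\<epsilon> c)" "P (h c) z" and d: "d \<in> {0..<1}"
  shows "\<exists>z\<in>ball (\<gamma> d) (\<epsilon> d). P (h d) z"
proof (rule locally_constant_on_interval[where P = "\<lambda>t. \<exists>z\<in>ball (\<gamma> t) (\<epsilon> t). P (h t) z"])
  fix t :: real assume t: "t \<in> {0..<1}"
  then obtain \<delta> where \<delta>: "\<delta> > 0" "\<And>s. s \<in> {0..<1} \<Longrightarrow> dist s t < \<delta> \<Longrightarrow>
      \<gamma> s \<in> ball (\<gamma> t) (\<epsilon> t) \<and> (\<forall>\<^sub>F z in nhds (\<gamma> s). h s z = h t z)"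
    using cont by blast
  have "(\<exists>z\<in>ball (\<gamma> s) (\<epsilon> s). P (h s) z) \<longleftrightarrow> (\<exists>z\<in>ball (\<gamma> t) (\<epsilon> t). P (h t) z)"
    if s: "s \<in> {0..<1}" "dist s t < \<delta>" for s
  proof -
    have st: "\<gamma> s \<in> ball (\<gamma> t) (\<epsilon> t)" "\<forall>\<^sub>F z in nhds (\<gamma> s). h s z = h t z" using \<delta>(2)[OF s] by auto
    then obtain N0 where N0: "open N0" "\<gamma> s \<in> N0" "\<And>z. z \<in> N0 \<Longrightarrow> h s z = h t z"
      unfolding eventually_nhds by blast
    \<comment> \<open>\<open>N\<close> lies in both discs and the two branches agree on it:
      \<open>dense\<close> moves \<open>P\<close> into \<open>N\<close> and \<open>cong\<close>
      hands it to the other branch, in either direction.\<close>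
    define N where "N = N0 \<inter> ball (\<gamma> s) (\<epsilon> s) \<inter> ball (\<gamma> t) (\<epsilon> t)"
    have N: "open N" "N \<noteq> {}" "N \<subseteq> ball (\<gamma> s) (\<epsilon> s)" "N \<subseteq> ball (\<gamma> t) (\<epsilon> t)"
      using N0 st(1) pos[OF s(1)] by (auto simp: N_def)
    have iff: "P (h s) y \<longleftrightarrow> P (h t) y" if "y \<in> N" for y
    proof -
      have "y \<in> N0" using that by (simp add: N_def)
      then have "\<forall>\<^sub>F z in nhds y. h s z = h t z" "\<forall>\<^sub>F z in nhds y. h t z = h s z"
        using N0(1,3) unfolding eventually_nhds by (metis, metis)
      then show ?thesis using cong by blast
    qed
    show ?thesis
      using iff dense[OF hol[OF s(1)] _ _ N(1,3,2)] dense[OF hol[OF t] _ _ N(1,4,2)] N(3,4) by blast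
  qed
  then show "\<exists>\<delta>>0. \<forall>s\<in>{0..<1}. dist s t < \<delta> \<longrightarrow>
      ((\<exists>z\<in>ball (\<gamma> s) (\<epsilon> s). P (h s) z) \<longleftrightarrow> (\<exists>z\<in>ball (\<gamma> t) (\<epsilon> t). P (h t) z))"
    using \<delta>(1) by blast
qed (use c d in auto)

text \<open>The intersection of \<open>B\<close> with the disc of \<open>h t\<close> is convex, so
  by the identity theorem agreement near one of its points is agreement throughout. Agreement of the
  germs is therefore locally constant in time.\<close>

lemma eq_along_path:
  assumes u: "u holomorphic_on B" "open B" "convex B"
    and \<gamma>: "\<And>s. s \<in> {c..<1} \<Longrightarrow> \<gamma> s \<in> B" and c: "c \<in> {0..<1}"
    and eq: "\<forall>\<^sub>F z in nhds (\<gamma> c). h c z = u z" and s: "s \<in> {c..<1}"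
  shows "\<forall>\<^sub>F z in nhds (\<gamma> s). h s z = u z"
proof (rule locally_constant_on_interval[where P = "\<lambda>t. \<forall>\<^sub>F z in nhds (\<gamma> t). h t z = u z"])
  fix t assume t: "t \<in> {c..<1}"
  then have t0: "t \<in> {0..<1}" using c by auto
  then obtain \<delta> where \<delta>: "\<delta> > 0" "\<And>s. s \<in> {0..<1} \<Longrightarrow> dist s t < \<delta> \<Longrightarrow>
      \<gamma> s \<in> ball (\<gamma> t) (\<epsilon> t) \<and> (\<forall>\<^sub>F z in nhds (\<gamma> s). h s z = h t z)"
    using cont by blast
  define D where "D = ball (\<gamma> t) (\<epsilon> t) \<inter> B"
  have D: "open D" "connected D" using u by (auto simp: D_def intro!: convex_connected convex_Int)
  have all: "\<forall>z\<in>D. h t z = u z" if y: "y \<in> D" "\<forall>\<^sub>F z in nhds y. h t z = u z" for y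
  proof
    fix z assume z: "z \<in> D"
    obtain N where N: "open N" "y \<in> N" "\<And>z. z \<in> N \<Longrightarrow> h t z = u z"
      using y(2) unfolding eventually_nhds by blast
    show "h t z = u z"
      by (rule analytic_continuation_open[of "N \<inter> D" D])
        (use N D y(1) z hol[OF t0] u(1) in \<open>auto simp: D_def intro: holomorphic_on_subset\<close>)
  qed
  have iff: "(\<forall>\<^sub>F z in nhds y. h t z = u z) \<longleftrightarrow> (\<forall>z\<in>D. h t z = u z)" if y: "y \<in> D" for y
    using all[OF y] eventually_nhds_in_open[OF D(1) y] by (auto elim!: eventually_mono)
  have "(\<forall>\<^sub>F z in nhds (\<gamma> s). h s z = u z) \<longleftrightarrow> (\<forall>\<^sub>F z in nhds (\<gamma> t). h t z = u z)"
    if s: "s \<in> {c..<1}" "dist s t < \<delta>" for s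
  proof -
    have s0: "s \<in> {0..<1}" using s c by auto
    have st: "\<gamma> s \<in> ball (\<gamma> t) (\<epsilon> t)" "\<forall>\<^sub>F z in nhds (\<gamma> s). h s z = h t z" using \<delta>(2)[OF s0 s(2)] by auto
    have sD: "\<gamma> s \<in> D" and tD: "\<gamma> t \<in> D" using st(1) pos[OF t0] \<gamma> s(1) t by (auto simp: D_def)
    have "(\<forall>\<^sub>F z in nhds (\<gamma> s). h s z = u z) \<longleftrightarrow> (\<forall>\<^sub>F z in nhds (\<gamma> s). h t z = u z)"
      by (rule eventually_subst) (use st(2) in \<open>eventually_elim, simp\<close>)
    also have "\<dots> \<longleftrightarrow> (\<forall>z\<in>D. h t z = u z)"
      by (rule iff[OF sD])
    also have "\<dots> \<longleftrightarrow> (\<forall>\<^sub>F z in nhds (\<gamma> t). h t z = u z)"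
      by (rule iff[OF tD, symmetric])
    finally show ?thesis .
  qed
  then show "\<exists>\<delta>>0. \<forall>s\<in>{c..<1}. dist s t < \<delta> \<longrightarrow>
     ((\<forall>\<^sub>F z in nhds (\<gamma> s). h s z = u z) \<longleftrightarrow> (\<forall>\<^sub>F z in nhds (\<gamma> t). h t z = u z))"
    using \<delta>(1) by blast
qed (use c eq s in auto)

end

section \<open>Branches of the right-hand side\<close>

lemma open_imp_fsigma:
  fixes A :: "'a::euclidean_space set"
  assumes "open A"
  shows "fsigma A"
proof (rule open_Union_compact_subsets[OF assms])
  fix C :: "nat \<Rightarrow> 'a set"
  assume "\<And>n. compact (C n)" and "\<Union>(range C) = A"
  then show ?thesis using fsigma.intros[of C] compact_imp_closed by auto
qed

text \<open>Constants are split off because countability of the zeros is a theorem about nonconstant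
  functions.\<close>

lemma countable_zeros_of_nonzero:
  assumes f: "f holomorphic_on A" "open A" "connected A" and z: "z \<in> A" "f z \<noteq> 0"
  shows "countable {x \<in> A. f x = 0}"
proof (cases "f constant_on A")
  case True
  then have "{x \<in> A. f x = 0} = {}" using z unfolding constant_on_def by auto
  then show ?thesis by (metis countable_empty)
next
  case False
  then show ?thesis using f by (intro holomorphic_countable_zeros open_imp_fsigma)
qed

lemma open_not_subset_countable:
  fixes N :: "complex set"
  assumes "open N" "N \<noteq> {}" "countable C"
  obtains y where "y \<in> N" "y \<notin> C"
proof -
  obtain x e where "e > 0" "ball x e \<subseteq> N"
    using assms(1,2) open_contains_ball by (metis ex_in_conv)
  then have "uncountable N" using uncountable_ball countable_subset by blast
  then have "\<not> N \<subseteq> C" using assms(3) countable_subset[of N C] by auto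
  then show thesis using that by auto
qed

text \<open>What remains of an evenly covered neighbourhood once \<open>\<Delta>\<close> and
  \<open>p\<close> are forgotten. The list is complete at every point of \<open>V\<close> and not
  just at one centre, so the equation can be followed from point to point. Completeness is up to
  germs, since admissible functions are arbitrary away from the point.\<close>

definition branch_cover ::
    "(complex \<times> complex \<Rightarrow> (complex \<times> complex \<Rightarrow> complex) \<Rightarrow> bool) \<Rightarrow>
     (complex \<times> complex) set \<Rightarrow> (complex \<times> complex \<Rightarrow> complex) set \<Rightarrow> bool" where
  "branch_cover E V \<G> \<longleftrightarrow> open V \<and> finite \<G> \<and>
     (\<forall>\<Phi>\<in>\<G>. \<Phi> mholomorphic_on V \<and> (\<forall>y\<in>V. E y \<Phi>)) \<and>
     (\<forall>y\<in>V. \<forall>\<Psi>. E y \<Psi> \<longrightarrow> (\<exists>\<Phi>\<in>\<G>. \<forall>\<^sub>F z in nhds y. \<Psi> z = \<Phi> z))"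

lemma branch_coverD:
  assumes "branch_cover E V \<G>"
  shows "open V" "finite \<G>" "\<Phi> \<in> \<G> \<Longrightarrow> \<Phi> mholomorphic_on V" "\<Phi> \<in> \<G> \<Longrightarrow> y \<in> V \<Longrightarrow> E y \<Phi>"
    "y \<in> V \<Longrightarrow> E y \<Psi> \<Longrightarrow> \<exists>\<Phi>\<in>\<G>. \<forall>\<^sub>F z in nhds y. \<Psi> z = \<Phi> z"
  using assms unfolding branch_cover_def by auto

text \<open>\<open>E x \<Phi>\<close> says that \<open>\<Phi>\<close> is, near \<open>x\<close>, one of the finitely many branches of the right-hand side
  of the differential equation; \<open>g\<close> is an equation of the curve containing the singularities.\<close>

locale rhs_family =
  fixes g :: "complex \<times> complex \<Rightarrow> complex"
    and E :: "complex \<times> complex \<Rightarrow> (complex \<times> complex \<Rightarrow> complex) \<Rightarrow> bool"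
  assumes g: "g mholomorphic_on UNIV"
    and branches: "g x \<noteq> 0 \<Longrightarrow> \<exists>V \<G>. x \<in> V \<and> (\<forall>y\<in>V. g y \<noteq> 0) \<and> branch_cover E V \<G>"
    and nonsingular: "E x \<Phi> \<Longrightarrow> g x \<noteq> 0"
begin

text \<open>The branch is bound inside and held constant only near \<open>z\<close>, so it may
  change along the arc. As \<open>E\<close> admits nothing over the curve, the property also records
  that the graph is off the curve at \<open>z\<close>.\<close>

definition solves :: "(complex \<Rightarrow> complex) \<Rightarrow> complex \<Rightarrow> bool" where
  "solves f z \<longleftrightarrow> (\<exists>\<Phi>. E (z, f z) \<Phi> \<and>
     (\<forall>\<^sub>F y in nhds z. (f has_field_derivative \<Phi> (y, f y)) (at y)))"

lemma solves_nonsingular: "solves f z \<Longrightarrow> g (z, f z) \<noteq> 0"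
  unfolding solves_def using nonsingular by blast

lemma solves_cong:
  assumes "solves f z" and eq: "\<forall>\<^sub>F y in nhds z. f y = k y"
  shows "solves k z"
proof -
  obtain \<Phi> where \<Phi>: "E (z, f z) \<Phi>" "\<forall>\<^sub>F y in nhds z. (f has_field_derivative \<Phi> (y, f y)) (at y)"
    using assms(1) unfolding solves_def by blast
  have "\<forall>\<^sub>F y in nhds z. \<forall>\<^sub>F x in nhds y. f x = k x"
    using eq by (simp add: eventually_eventually)
  then have "\<forall>\<^sub>F y in nhds z. (k has_field_derivative \<Phi> (y, k y)) (at y)"
    using \<Phi>(2)
  proof eventually_elim
    case (elim y)
    have "f y = k y" using eventually_nhds_x_imp_x[OF elim(1)] .
    then show ?case using elim DERIV_cong_ev[OF refl elim(1) refl] by simp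
  qed
  moreover have "f z = k z" using eventually_nhds_x_imp_x[OF eq] .
  ultimately show ?thesis using \<Phi>(1) unfolding solves_def by auto
qed

text \<open>Continuity of \<open>f\<close> keeps \<open>(y, f y)\<close> where \<open>\<Psi>\<close>
  and \<open>\<Phi>\<close> agree, so an arbitrary admissible branch may be traded for one from
  \<open>\<G>\<close>.\<close>

lemma solves_branch:
  assumes sol: "solves f z"
    and \<G>: "\<And>\<Psi>. E (z, f z) \<Psi> \<Longrightarrow> \<exists>\<Phi>\<in>\<G>. \<forall>\<^sub>F x in nhds (z, f z). \<Psi> x = \<Phi> x"
  shows "\<exists>\<Phi>\<in>\<G>. \<forall>\<^sub>F y in nhds z. (f has_field_derivative \<Phi> (y, f y)) (at y)"
proof -
  obtain \<Psi> where \<Psi>: "E (z, f z) \<Psi>" "\<forall>\<^sub>F y in nhds z. (f has_field_derivative \<Psi> (y, f y)) (at y)"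
    using sol unfolding solves_def by blast
  obtain \<Phi> where \<Phi>: "\<Phi> \<in> \<G>" "\<forall>\<^sub>F x in nhds (z, f z). \<Psi> x = \<Phi> x"
    using \<G>[OF \<Psi>(1)] by blast
  have "isCont f z" using eventually_nhds_x_imp_x[OF \<Psi>(2)] DERIV_isCont by blast
  then have "(f \<longlongrightarrow> f z) (nhds z)"
    by (simp add: isCont_def tendsto_at_iff_tendsto_nhds)
  then have "((\<lambda>y. (y, f y)) \<longlongrightarrow> (z, f z)) (nhds z)"
    by (intro tendsto_Pair filterlim_ident)
  from eventually_compose_filterlim[OF \<Phi>(2) this]
  have "\<forall>\<^sub>F y in nhds z. \<Psi> (y, f y) = \<Phi> (y, f y)" .
  with \<Psi>(2) have "\<forall>\<^sub>F y in nhds z. (f has_field_derivative \<Phi> (y, f y)) (at y)"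
    by eventually_elim simp
  then show ?thesis using \<Phi>(1) by blast
qed

text \<open>Over a small disc the graph lies in one branch cover. A branch valid near
  \<open>x\<close> makes \<open>deriv f\<close> and \<open>\<Phi> (z, f z)\<close> equal on an open
  set, hence on the whole disc by the identity theorem; connectedness of \<open>N\<close> does the
  rest.\<close>

lemma solves_spread:
  assumes f: "f holomorphic_on N" "open N" "connected N"
    and ns: "\<And>z. z \<in> N \<Longrightarrow> g (z, f z) \<noteq> 0" and a: "a \<in> N" "solves f a" and b: "b \<in> N"
  shows "solves f b"
proof (rule connected_induction_simple[where P = "solves f", OF f(3) a(1) b a(2)])
  fix c assume c: "c \<in> N"
  obtain V \<G> where cV: "(c, f c) \<in> V" and "branch_cover E V \<G>"
    using branches[OF ns[OF c]] by blast
  note \<G> = branch_coverD[OF this(2)]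
  have "continuous_on N (\<lambda>z. (z, f z))"
    using f(1) by (intro continuous_intros holomorphic_on_imp_continuous_on)
  then have "open (N \<inter> (\<lambda>z. (z, f z)) -` V)"
    using f(2) \<G>(1) by (rule continuous_open_preimage)
  moreover have "c \<in> N \<inter> (\<lambda>z. (z, f z)) -` V" using c cV by simp
  ultimately obtain e where e: "e > 0" "ball c e \<subseteq> N \<inter> (\<lambda>z. (z, f z)) -` V"
    using open_contains_ball by blast
  then have eN: "ball c e \<subseteq> N" and eV: "\<And>z. z \<in> ball c e \<Longrightarrow> (z, f z) \<in> V" by auto
  have fe: "f holomorphic_on ball c e" using f(1) eN by (rule holomorphic_on_subset)
  have spread: "solves f y" if x: "x \<in> ball c e" "solves f x" and y: "y \<in> ball c e" for x y
  proof -
    obtain \<Phi> where \<Phi>: "\<Phi> \<in> \<G>" "\<forall>\<^sub>F z in nhds x. (f has_field_derivative \<Phi> (z, f z)) (at z)"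
      using solves_branch[OF x(2), of \<G>] \<G>(5)[OF eV[OF x(1)]] by blast
    obtain N' where N': "open N'" "x \<in> N'" "\<And>z. z \<in> N' \<Longrightarrow> (f has_field_derivative \<Phi> (z, f z)) (at z)"
      using \<Phi>(2) unfolding eventually_nhds by blast
    have D: "(f has_field_derivative \<Phi> (z, f z)) (at z)" if z: "z \<in> ball c e" for z
    proof -
      have "deriv f z = \<Phi> (z, f z)"
      proof (rule analytic_continuation_open[of "N' \<inter> ball c e" "ball c e" "deriv f" "\<lambda>z. \<Phi> (z, f z)"])
        show "deriv f holomorphic_on ball c e" using fe by (rule holomorphic_deriv) simp
        show "(\<lambda>z. \<Phi> (z, f z)) holomorphic_on ball c e"
          using holomorphic_graph_compose[OF \<G>(3)[OF \<Phi>(1)] fe open_ball eV] .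
        show "deriv f w = \<Phi> (w, f w)" if "w \<in> N' \<inter> ball c e" for w
          using N'(3) that DERIV_imp_deriv by blast
      qed (use N' x z in auto)
      then show ?thesis using holomorphic_derivI[OF fe open_ball z] by simp
    qed
    have "\<forall>\<^sub>F z in nhds y. (f has_field_derivative \<Phi> (z, f z)) (at z)"
      using eventually_nhds_in_open[OF open_ball y] by eventually_elim (rule D)
    then show ?thesis unfolding solves_def using \<G>(4)[OF \<Phi>(1) eV[OF y]] by blast
  qed
  show "\<exists>T. openin (top_of_set N) T \<and> c \<in> T \<and> (\<forall>x\<in>T. \<forall>y\<in>T. solves f x \<longrightarrow> solves f y)"
  proof (intro exI[of _ "ball c e"] conjI ballI impI)
    show "openin (top_of_set N) (ball c e)" using eN by (simp add: open_subset)
    show "c \<in> ball c e" using e(1) by simp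
  qed (rule spread)
qed

lemma countable_singular_graph:
  assumes f: "f holomorphic_on ball b e" and z: "z \<in> ball b e" "g (z, f z) \<noteq> 0"
  shows "countable {x \<in> ball b e. g (x, f x) = 0}"
  using holomorphic_graph_compose[OF g f]
  by (intro countable_zeros_of_nonzero[where z = z and f = "\<lambda>x. g (x, f x)"] z) auto

text \<open>The points where the graph meets the curve are countable because \<open>y\<close> is not
  one of them; removing them leaves a connected open set, to which \<open>solves_spread\<close>
  applies.\<close>

lemma solves_on_ball:
  assumes f: "f holomorphic_on ball b e" and z: "z \<in> ball b e" "solves f z"
    and y: "y \<in> ball b e" "g (y, f y) \<noteq> 0"
  shows "solves f y"
proof -
  define C where "C = {x \<in> ball b e. g (x, f x) = 0}"
  have C: "countable C" unfolding C_def by (rule countable_singular_graph[OF f y])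
  have "(\<lambda>x. g (x, f x)) holomorphic_on ball b e"
    using holomorphic_graph_compose[OF g f] by simp
  then have "open (ball b e \<inter> (\<lambda>x. g (x, f x)) -` (- {0}))"
    by (intro continuous_open_preimage holomorphic_on_imp_continuous_on) auto
  moreover have "ball b e \<inter> (\<lambda>x. g (x, f x)) -` (- {0}) = ball b e - C" by (auto simp: C_def)
  ultimately have "open (ball b e - C)" by simp
  moreover have "connected (ball b e - C)"
    using C by (intro connected_open_diff_countable) auto
  ultimately show ?thesis
  proof (rule solves_spread[rotated])
    show "f holomorphic_on ball b e - C" using f by (rule holomorphic_on_subset) auto
    show "g (x, f x) \<noteq> 0" if "x \<in> ball b e - C" for x using that by (simp add: C_def)
    show "z \<in> ball b e - C" using z(1) solves_nonsingular[OF z(2)] by (simp add: C_def)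
    show "solves f z" by (rule z(2))
    show "y \<in> ball b e - C" using y by (simp add: C_def)
  qed
qed

end

text \<open>\<open>initial\<close> is conditional because nothing keeps the initial graph off the
  curve: it may start on it or even lie inside it.\<close>

locale rhs_family_path = rhs_family g E + path_continuation \<gamma> \<epsilon> h
  for g E \<gamma> \<epsilon> h +
  fixes f :: "real \<Rightarrow> complex"
  assumes path: "continuous_on {0..1} \<gamma>"
    and f_eq: "t \<in> {0..<1} \<Longrightarrow> h t (\<gamma> t) = f t"
    and f_cont: "continuous_on {0..<1} f"
    and initial: "\<forall>\<^sub>F z in nhds (\<gamma> 0). g (z, h 0 z) \<noteq> 0 \<longrightarrow> solves (h 0) z"
    and vertical: "\<exists>v. g (\<gamma> 1, v) \<noteq> 0"
begin

text \<open>A round trip: nonsingularity at time \<open>s\<close> is carried back to time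
  \<open>0\<close>, so the initial graph does not lie in the curve. Points where it is off the curve
  then exist arbitrarily close to \<open>\<gamma> 0\<close>; \<open>initial\<close> applies there,
  and solving is carried forward to \<open>s\<close>.\<close>

lemma solves_along_path:
  assumes s: "s \<in> {0..<1}" "g (\<gamma> s, f s) \<noteq> 0"
  shows "solves (h s) (\<gamma> s)"
proof -
  have s0: "(0::real) \<in> {0..<1}" by simp
  let ?B = "\<lambda>t. ball (\<gamma> t) (\<epsilon> t)"
  have B: "\<gamma> t \<in> ?B t" if "t \<in> {0..<1}" for t using pos[OF that] by simp
  have "\<exists>z\<in>?B 0. g (z, h 0 z) \<noteq> 0"
  proof (rule propagate[where P = "\<lambda>f z. g (z, f z) \<noteq> 0"])
    show "g (z, k z) \<noteq> 0" if "g (z, f z) \<noteq> 0" "\<forall>\<^sub>F y in nhds z. f y = k y" for f k z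
      using that(1) eventually_nhds_x_imp_x[OF that(2)] by simp
    show "\<exists>y\<in>N. g (y, f y) \<noteq> 0"
      if "f holomorphic_on ball b e" "z \<in> ball b e" "g (z, f z) \<noteq> 0" "open N" "N \<subseteq> ball b e" "N \<noteq> {}"
      for f b e z N
      using open_not_subset_countable[OF that(4,6) countable_singular_graph[OF that(1-3)]] that(5) by blast
    show "g (\<gamma> s, h s (\<gamma> s)) \<noteq> 0" using s f_eq by simp
  qed (use s B s0 in blast)+
  then obtain z where z: "z \<in> ?B 0" "g (z, h 0 z) \<noteq> 0" by blast
  obtain N where N: "open N" "\<gamma> 0 \<in> N" "\<And>z. z \<in> N \<Longrightarrow> g (z, h 0 z) \<noteq> 0 \<Longrightarrow> solves (h 0) z"
    using initial unfolding eventually_nhds by blast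
  obtain y where y: "y \<in> N \<inter> ?B 0" "y \<notin> {x \<in> ?B 0. g (x, h 0 x) = 0}"
    using open_not_subset_countable[OF _ _ countable_singular_graph[OF hol[OF s0] z], of "N \<inter> ?B 0"]
      N(1,2) B[OF s0] by blast
  then have y: "y \<in> ?B 0" "solves (h 0) y" using N(3) by auto
  have "\<exists>z\<in>?B s. solves (h s) z"
  proof (rule propagate[where P = solves])
    show "\<exists>y\<in>N. solves f y"
      if *: "f holomorphic_on ball b e" "z \<in> ball b e" "solves f z" "open N" "N \<subseteq> ball b e" "N \<noteq> {}"
      for f b e z N
    proof -
      obtain y where "y \<in> N" "y \<notin> {x \<in> ball b e. g (x, f x) = 0}"
        using open_not_subset_countable[OF *(4,6) countable_singular_graph[OF *(1,2) solves_nonsingular[OF *(3)]]]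
        by blast
      then show ?thesis using solves_on_ball[OF *(1-3)] *(5) by blast
    qed
  qed (use solves_cong y s s0 in blast)+
  then show ?thesis
    using solves_on_ball[OF hol[OF s(1)]] B[OF s(1)] s f_eq by auto
qed

lemma limit_if_cluster_point_nonsingular:
  assumes v0: "g (\<gamma> 1, v0) \<noteq> 0"
    and cl: "\<And>\<rho> t. \<rho> > 0 \<Longrightarrow> t < 1 \<Longrightarrow> \<exists>s. t < s \<and> s < 1 \<and> dist (f s) v0 < \<rho>"
  shows "\<exists>l. (f \<longlongrightarrow> l) (at_left 1)"
proof -
  obtain V \<G> where V: "(\<gamma> 1, v0) \<in> V" and Vg: "\<forall>y\<in>V. g y \<noteq> 0" and "branch_cover E V \<G>"
    using branches[OF v0] by blast
  note \<G> = branch_coverD[OF this(3)]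
  define good where "good \<Phi> \<rho> \<longleftrightarrow> \<rho> > 0 \<and> (\<forall>z1\<in>ball (\<gamma> 1) \<rho>. \<forall>w1\<in>ball v0 \<rho>.
    \<exists>u. u holomorphic_on ball (\<gamma> 1) \<rho> \<and>
      (\<forall>h. h z1 = w1 \<and> (\<forall>\<^sub>F z in nhds z1. (h has_field_derivative \<Phi> (z, h z)) (at z)) \<longrightarrow>
         (\<forall>\<^sub>F z in nhds z1. h z = u z)))" for \<Phi> \<rho>
  have "\<exists>\<rho>. good \<Phi> \<rho>" if "\<Phi> \<in> \<G>" for \<Phi>
  proof (rule uniform_local_solution[OF \<G>(3)[OF that] \<G>(1) V])
    fix \<rho> :: real
    assume "\<rho> > 0" and "\<And>z1 w1. z1 \<in> ball (\<gamma> 1) \<rho> \<Longrightarrow> w1 \<in> ball v0 \<rho> \<Longrightarrow>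
      \<exists>u. u holomorphic_on ball (\<gamma> 1) \<rho> \<and>
        (\<forall>h. h z1 = w1 \<and> (\<forall>\<^sub>F z in nhds z1. (h has_field_derivative \<Phi> (z, h z)) (at z)) \<longrightarrow>
           (\<forall>\<^sub>F z in nhds z1. h z = u z))"
    then have "good \<Phi> \<rho>" unfolding good_def by (intro conjI ballI)
    then show ?thesis ..
  qed
  then obtain \<rho> where \<rho>: "\<And>\<Phi>. \<Phi> \<in> \<G> \<Longrightarrow> good \<Phi> (\<rho> \<Phi>)" by metis
  obtain A B where AB: "open A" "open B" "(\<gamma> 1, v0) \<in> A \<times> B" "A \<times> B \<subseteq> V"
    using \<G>(1) V open_prod_elim by blast
  obtain e1 where e1: "e1 > 0" "ball (\<gamma> 1) e1 \<subseteq> A"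
    using AB open_contains_ball by (metis SigmaD1)
  obtain e2 where e2: "e2 > 0" "ball v0 e2 \<subseteq> B"
    using AB open_contains_ball by (metis SigmaD2)
  \<comment> \<open>The time \<open>s\<close> is chosen before the branch at \<open>s\<close> is
    known, so \<open>r\<close> must lie below the radii of all branches, which are finitely many.
    With \<open>e1\<close> and \<open>e2\<close> it also places the graph point at time
    \<open>s\<close> in \<open>V\<close>.\<close>
  define r where "r = Min (insert e1 (insert e2 (\<rho> ` \<G>)))"
  have "r > 0" unfolding r_def
    using \<G>(2) e1 e2 \<rho> by (subst Min_gr_iff) (auto simp: good_def)
  moreover have r_le: "r \<le> e1" "r \<le> e2" "\<And>\<Phi>. \<Phi> \<in> \<G> \<Longrightarrow> r \<le> \<rho> \<Phi>"
    unfolding r_def using \<G>(2) by (intro Min_le; simp)+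
  ultimately have r: "r > 0" "r \<le> e1" "r \<le> e2" by auto
  obtain d where d: "d > 0" "\<And>t. t \<in> {0..1} \<Longrightarrow> dist t 1 < d \<Longrightarrow> \<gamma> t \<in> ball (\<gamma> 1) r"
    using path r(1) unfolding continuous_on_iff by (metis atLeastAtMost_iff dist_commute le_numeral_extra(4) mem_ball zero_le_one)
  \<comment> \<open>From \<open>s\<close> on, \<open>\<gamma>\<close> has to remain in the disc of
    the solution; cluster times occur arbitrarily late, so \<open>s\<close> can be taken after this
    threshold.\<close>
  have near: "\<gamma> t \<in> ball (\<gamma> 1) r" if "max 0 (1 - d) < t" "t < 1" for t
    using that by (intro d(2)) (auto simp: dist_real_def)
  have "max 0 (1 - d) < 1" using d(1) by simp
  then obtain s where s: "max 0 (1 - d) < s" "s < 1" "dist (f s) v0 < r" using cl[OF r(1)] by blast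
  have s0: "s \<in> {0..<1}" using s by auto
  have "\<gamma> s \<in> A" "f s \<in> B"
    using near[OF s(1,2)] s(3) r e1(2) e2(2) by (auto simp: dist_commute subset_iff)
  then have sV: "(\<gamma> s, f s) \<in> V" using AB(4) by blast
  have hs: "h s (\<gamma> s) = f s" using f_eq[OF s0] .
  have ns: "g (\<gamma> s, f s) \<noteq> 0" using Vg sV by blast
  have sol: "solves (h s) (\<gamma> s)" using s0 ns by (rule solves_along_path)
  obtain \<Phi> where \<Phi>: "\<Phi> \<in> \<G>" "\<forall>\<^sub>F y in nhds (\<gamma> s). (h s has_field_derivative \<Phi> (y, h s y)) (at y)"
    using solves_branch[OF sol, of \<G>] \<G>(5)[of "(\<gamma> s, h s (\<gamma> s))"] sV hs by auto
  have good: "good \<Phi> (\<rho> \<Phi>)" and le: "r \<le> \<rho> \<Phi>" using \<rho> r_le \<Phi>(1) by auto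
  have "\<gamma> s \<in> ball (\<gamma> 1) (\<rho> \<Phi>)" "f s \<in> ball v0 (\<rho> \<Phi>)"
    using near[OF s(1,2)] s(3) le by (auto simp: dist_commute)
  then obtain u where u: "u holomorphic_on ball (\<gamma> 1) (\<rho> \<Phi>)"
    "\<And>h. h (\<gamma> s) = f s \<Longrightarrow> \<forall>\<^sub>F z in nhds (\<gamma> s). (h has_field_derivative \<Phi> (z, h z)) (at z) \<Longrightarrow>
      \<forall>\<^sub>F z in nhds (\<gamma> s). h z = u z"
    using good unfolding good_def by meson
  have "f t = u (\<gamma> t)" if t: "t \<in> {s..<1}" for t
  proof -
    have "\<forall>\<^sub>F z in nhds (\<gamma> t). h t z = u z"
    proof (rule eq_along_path[OF u(1) open_ball convex_ball _ s0 u(2)[OF hs \<Phi>(2)] t])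
      show "\<gamma> x \<in> ball (\<gamma> 1) (\<rho> \<Phi>)" if "x \<in> {s..<1}" for x
        using near[of x] that s(1) le by auto
    qed
    from eventually_nhds_x_imp_x[OF this] show ?thesis using f_eq[of t] t s0 by simp
  qed
  then have "\<forall>\<^sub>F t in at_left 1. u (\<gamma> t) = f t"
    unfolding eventually_at_left_field using s(2) by (intro exI[of _ s]) auto
  moreover have "((\<lambda>t. u (\<gamma> t)) \<longlongrightarrow> u (\<gamma> 1)) (at_left 1)"
  proof (rule isCont_tendsto_compose[where g = u and f = \<gamma> and l = "\<gamma> 1"])
    have "\<rho> \<Phi> > 0" using good by (simp add: good_def)
    then show "isCont u (\<gamma> 1)"
      using holomorphic_on_imp_continuous_on[OF u(1)] by (simp add: continuous_on_eq_continuous_at)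
    have "(\<gamma> \<longlongrightarrow> \<gamma> 1) (at 1 within {0..1})" using path by (simp add: continuous_on)
    then show "(\<gamma> \<longlongrightarrow> \<gamma> 1) (at_left 1)" by (simp add: at_within_Icc_at_left)
  qed
  ultimately have "(f \<longlongrightarrow> u (\<gamma> 1)) (at_left 1)" by (rule Lim_transform_eventually[rotated])
  then show ?thesis ..
qed

theorem limit_exists:
  "(\<exists>l. (f \<longlongrightarrow> l) (at_left 1)) \<or> filterlim f at_infinity (at_left 1)"
proof (rule ccontr)
  assume c: "\<not> ?thesis"
  define Z where "Z = {v \<in> UNIV. g (\<gamma> 1, v) = 0}"
  have line: "(\<gamma> 1, 0) + scaleC c (0, 1) = (\<gamma> 1, c)" for c :: complex
    by (simp add: scaleC_prod_def scaleC_complex_def)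
  have "(\<lambda>c. g ((\<gamma> 1, 0) + scaleC c (0, 1))) holomorphic_on UNIV"
    by (rule holomorphic_on_line(1)[OF g]) auto
  then have "(\<lambda>c. g (\<gamma> 1, c)) holomorphic_on UNIV" by (simp only: line)
  moreover obtain v where "g (\<gamma> 1, v) \<noteq> 0" using vertical by blast
  ultimately have "countable Z"
    unfolding Z_def by (intro countable_zeros_of_nonzero[where z = v]) auto
  then obtain v0 where "v0 \<notin> Z" "\<And>\<rho> t. \<rho> > 0 \<Longrightarrow> t < 1 \<Longrightarrow> \<exists>s. t < s \<and> s < 1 \<and> dist (f s) v0 < \<rho>"
    using no_limit_imp_cluster_point[OF f_cont] c by auto
  then show False
    using limit_if_cluster_point_nonsingular c by (auto simp: Z_def)
qed

end

section \<open>The Cauchy problem\<close>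

text \<open>Keeping \<open>W\<close> off the curve keeps the section off \<open>\<Sigma>\<close>
  whenever the curve contains the image of \<open>\<Sigma>\<close>. Continuity is all that is asked
  of the section, so \<open>\<eta>\<close> and the sheets of an evenly covered set both
  qualify.\<close>

definition rhs_germ ::
    "('a, complex \<times> complex) cmfd \<Rightarrow> ('a \<Rightarrow> complex \<times> complex) \<Rightarrow> ('a \<Rightarrow> complex) \<Rightarrow> (complex \<times> complex) set \<Rightarrow>
     complex \<times> complex \<Rightarrow> (complex \<times> complex \<Rightarrow> complex) \<Rightarrow> bool" where
  "rhs_germ M p F S x \<Phi> \<longleftrightarrow>
     (\<exists>W \<sigma>. x \<in> W \<and> W \<inter> S = {} \<and> local_section M p W \<sigma> \<and> (\<forall>y\<in>W. \<Phi> y = F (\<sigma> y)))"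

text \<open>The branches are \<open>F\<close> composed with the sheets over an evenly covered
  neighbourhood, cut down to the complement of the curve. The list is complete because a section
  through a point of \<open>\<Delta>\<close> has the germ of the sheet through that point.\<close>

lemma rhs_family_rhs_germ:
  fixes \<Delta> :: "('a, complex \<times> complex) cmfd"
  assumes \<Delta>: "proper_riemann_domain (- \<B>) \<Delta> p"
    and F: "holomorphic_map (open_submanifold \<Delta> (points \<Delta> - \<Sigma>)) (open_domain UNIV) F"
    and g: "g mholomorphic_on UNIV" and S: "\<B> \<union> p ` \<Sigma> \<subseteq> {x. g x = 0}"
  shows "rhs_family g (rhs_germ \<Delta> p F {x. g x = 0})"
proof
  define S where "S = {x. g x = (0::complex)}"
  have mfd: "complex_manifold \<Delta>"
    using \<Delta> by (simp add: proper_riemann_domain_def riemann_domain_def)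
  have cl: "open (- S)"
  proof -
    have "open (UNIV \<inter> g -` (- {0}))"
      using g by (intro continuous_open_preimage mholomorphic_on_imp_continuous_on) auto
    then show ?thesis by (simp add: S_def vimage_def Compl_eq)
  qed
  show "g mholomorphic_on UNIV" by (rule g)
  show "g x \<noteq> 0" if "rhs_germ \<Delta> p F {x. g x = 0} x \<Phi>" for x \<Phi>
    using that unfolding rhs_germ_def by blast
  fix x assume "g x \<noteq> 0"
  then have x: "x \<in> - S" by (simp add: S_def)
  then have "x \<in> - \<B>" using S by (auto simp: S_def)
  then obtain V \<G> where V: "open V" "x \<in> V" "V \<subseteq> - \<B>" "finite \<G>"
    and sec: "\<forall>\<sigma>\<in>\<G>. \<exists>V'. V \<subseteq> V' \<and> holomorphic_section \<Delta> p V' \<sigma>"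
    and cov: "\<forall>y\<in>points \<Delta>. p y \<in> V \<longrightarrow> (\<exists>\<sigma>\<in>\<G>. \<sigma> (p y) = y)"
    using proper_riemann_domain_evenly_covered[OF \<Delta>] by metis
  define W where "W = V \<inter> - S"
  have W: "open W" "x \<in> W" "W \<subseteq> V" "W \<inter> S = {}"
    using V(1,2) cl x by (auto simp: W_def)
  have "(F \<circ> \<sigma>) mholomorphic_on W \<and> (\<forall>y\<in>W. rhs_germ \<Delta> p F S y (F \<circ> \<sigma>))" if \<sigma>: "\<sigma> \<in> \<G>" for \<sigma>
  proof -
    obtain V' where V': "V \<subseteq> V'" "holomorphic_section \<Delta> p V' \<sigma>" using sec \<sigma> by blast
    then have "local_section \<Delta> p V' \<sigma>" by (simp add: holomorphic_section_def)
    then have ls: "local_section \<Delta> p W \<sigma>"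
      using W(1,3) V'(1) by (auto intro: local_section_subset[where V = V'])
    have "\<sigma> y \<in> points \<Delta> - \<Sigma>" if y: "y \<in> W" for y
    proof -
      have "p (\<sigma> y) = y" using ls y by (simp add: local_section_def)
      moreover have "y \<notin> p ` \<Sigma>" using S W(4) y by (auto simp: S_def)
      ultimately show ?thesis using local_section_in_points[OF ls y] by force
    qed
    then have "(F \<circ> \<sigma>) mholomorphic_on W"
      using W(1,3) V'(1) by (intro holomorphic_map_compose_section[OF mfd F V'(2)]) auto
    moreover have "rhs_germ \<Delta> p F S y (F \<circ> \<sigma>)" if "y \<in> W" for y
      unfolding rhs_germ_def using that W(4) ls by (intro exI[of _ W] exI[of _ \<sigma>]) auto
    ultimately show ?thesis by blast
  qed
  moreover have "\<exists>\<Phi>\<in>(\<lambda>\<sigma>. F \<circ> \<sigma>) ` \<G>. \<forall>\<^sub>F z in nhds y. \<Psi> z = \<Phi> z"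
    if y: "y \<in> W" and \<Psi>: "rhs_germ \<Delta> p F S y \<Psi>" for y \<Psi>
  proof -
    obtain N \<tau> where N: "y \<in> N" "local_section \<Delta> p N \<tau>" "\<And>z. z \<in> N \<Longrightarrow> \<Psi> z = F (\<tau> z)"
      using \<Psi> unfolding rhs_germ_def by blast
    have py: "p (\<tau> y) = y" using N by (simp add: local_section_def)
    then obtain \<sigma> where \<sigma>: "\<sigma> \<in> \<G>" "\<sigma> y = \<tau> y"
      using cov local_section_in_points[OF N(2,1)] y W(3) by (metis subsetD)
    obtain V' where V': "V \<subseteq> V'" "holomorphic_section \<Delta> p V' \<sigma>" using sec \<sigma>(1) by blast
    have "\<tau> y \<in> \<sigma> ` V'" using \<sigma>(2) y W(3) V'(1) by (metis imageI subsetD)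
    from local_section_germ_unique[OF V'(2) N(2,1) this]
    have eq: "\<forall>\<^sub>F z in nhds y. \<tau> z = \<sigma> z" .
    have "open N" using N(2) by (simp add: local_section_def)
    from eventually_nhds_in_open[OF this N(1)] eq
    have "\<forall>\<^sub>F z in nhds y. \<Psi> z = (F \<circ> \<sigma>) z"
      by eventually_elim (simp add: N(3))
    then show ?thesis using \<sigma>(1) by blast
  qed
  ultimately have "branch_cover (rhs_germ \<Delta> p F S) W ((\<lambda>\<sigma>. F \<circ> \<sigma>) ` \<G>)"
    unfolding branch_cover_def using W(1) V(4) by blast
  moreover have "\<forall>y\<in>W. g y \<noteq> 0" using W(4) by (auto simp: S_def)
  ultimately show "\<exists>V \<G>. x \<in> V \<and> (\<forall>y\<in>V. g y \<noteq> 0) \<and> branch_cover (rhs_germ \<Delta> p F {x. g x = 0}) V \<G>"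
    using W(2) unfolding S_def by blast
qed

text \<open>Since \<open>\<eta>\<close> is itself a section of \<open>p\<close>,
  \<open>F \<circ> \<eta>\<close> is an admissible branch off the curve. The bidisc may meet the
  curve, so it is cut down before \<open>\<eta>\<close> serves as witness.\<close>

lemma initial_solution_solves:
  fixes \<Delta> :: "('a, complex \<times> complex) cmfd"
  assumes fam: "rhs_family g (rhs_germ \<Delta> p F {x. g x = 0})"
    and \<eta>: "local_section \<Delta> p (ball z0 r1 \<times> ball w0 r2) \<eta>"
    and w: "initial_solution F z0 w0 r1 r2 \<eta> r w"
    and z: "z \<in> ball z0 r" "g (z, w z) \<noteq> 0"
  shows "rhs_family.solves (rhs_germ \<Delta> p F {x. g x = 0}) w z"
proof -
  interpret rhs_family g "rhs_germ \<Delta> p F {x. g x = 0}" by (rule fam)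
  let ?D = "ball z0 r1 \<times> ball w0 r2"
  have w: "\<And>z. z \<in> ball z0 r \<Longrightarrow> (z, w z) \<in> ?D"
    "\<And>z. z \<in> ball z0 r \<Longrightarrow> (w has_field_derivative F (\<eta> (z, w z))) (at z)"
    using w by (auto simp: initial_solution_def)
  have "open (UNIV \<inter> g -` (- {0}))"
    using g by (intro continuous_open_preimage mholomorphic_on_imp_continuous_on) auto
  then have "open {x. g x \<noteq> 0}" by (simp add: vimage_def Compl_eq)
  moreover have "open ?D" using \<eta> by (simp add: local_section_def)
  ultimately have "local_section \<Delta> p (?D \<inter> {x. g x \<noteq> 0}) \<eta>"
    using \<eta> by (intro local_section_subset[OF \<eta>] open_Int) auto
  then have "rhs_germ \<Delta> p F {x. g x = 0} (z, w z) (F \<circ> \<eta>)"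
    unfolding rhs_germ_def using z(2) w(1)[OF z(1)]
    by (intro exI[of _ "?D \<inter> {x. g x \<noteq> 0}"] exI[of _ \<eta>]) auto
  moreover have "\<forall>\<^sub>F y in nhds z. (w has_field_derivative (F \<circ> \<eta>) (y, w y)) (at y)"
    using eventually_nhds_in_open[OF open_ball z(1)] by eventually_elim (simp add: w(2))
  ultimately show ?thesis unfolding solves_def by blast
qed

theorem theorem4p1:
  fixes \<B> \<S> :: "(complex \<times> complex) set"
    and \<Delta> :: "('d, complex \<times> complex) cmfd" and p :: "'d \<Rightarrow> complex \<times> complex"
    and \<Sigma> :: "'d set" and F :: "'d \<Rightarrow> complex" and X0 :: 'd and z0 w0 :: complex
    and r1 r2 r :: real and \<eta> :: "complex \<times> complex \<Rightarrow> 'd" and w :: "complex \<Rightarrow> complex"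
    and \<gamma> :: "real \<Rightarrow> complex"
    and R :: "('r, complex) cmfd" and \<pi> :: "'r \<Rightarrow> complex" and j :: "complex \<Rightarrow> 'r"
    and \<omega> :: "'r \<Rightarrow> complex" and \<gamma>' :: "real \<Rightarrow> 'r"
  assumes "cauchy_data \<B> \<Delta> p \<Sigma> F X0 z0 w0 r1 r2 \<eta>"
    and "initial_solution F z0 w0 r1 r2 \<eta> r w"
    and "analytic_curve \<S>" and "\<B> \<union> p ` \<Sigma> \<subseteq> \<S>"
    and "continuous_on {0..1} \<gamma>" and "\<gamma> 0 = z0"
    and "\<not> {(z, v). z = \<gamma> 1} \<subseteq> \<S>"
    and "regular_continuation_along {0..<1} \<gamma> (ball z0 r) w (open_domain UNIV) R \<pi> j \<omega>"
    and "lifted_arc {0..<1} \<gamma> R \<pi> j \<gamma>'"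
  shows "(\<exists>l. ((\<omega> \<circ> \<gamma>') \<longlongrightarrow> l) (at_left 1)) \<or>
         filterlim (\<omega> \<circ> \<gamma>') at_infinity (at_left 1)"
proof -
  obtain g :: "complex \<times> complex \<Rightarrow> complex" where g_hol: "g mholomorphic_on UNIV" and \<S>: "\<S> = {x. g x = 0}"
    using assms(3) unfolding analytic_curve_def by blast
  note cd = assms(1)[unfolded cauchy_data_def]
  have \<Delta>: "proper_riemann_domain (- \<B>) \<Delta> p"
    and F: "holomorphic_map (open_submanifold \<Delta> (points \<Delta> - \<Sigma>)) (open_domain UNIV) F"
    and \<eta>h: "holomorphic_map (open_domain (ball z0 r1 \<times> ball w0 r2)) \<Delta> \<eta>"
    and \<eta>p: "\<forall>x \<in> ball z0 r1 \<times> ball w0 r2. p (\<eta> x) = x \<and> \<eta> x \<in> points \<Delta> - \<Sigma>"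
    using cd by blast+
  have \<eta>: "local_section \<Delta> p (ball z0 r1 \<times> ball w0 r2) \<eta>"
    using \<eta>h \<eta>p by (auto simp: local_section_def holomorphic_map_def open_domain_def open_Times)
  have fam: "rhs_family g (rhs_germ \<Delta> p F {x. g x = 0})"
    using \<Delta> F g_hol assms(4) unfolding \<S> by (rule rhs_family_rhs_germ)
  have r: "r > 0" using assms(2) by (simp add: initial_solution_def)
  have rc: "regular_continuation (ball z0 r) w (open_domain UNIV) R \<pi> j \<omega>"
    using assms(8) by (simp add: regular_continuation_along_def)
  then have R: "riemann_domain (\<pi> ` points R) R \<pi>" and jh: "holomorphic_map (open_domain (ball z0 r)) R j"
    and \<pi>j: "\<And>z. z \<in> ball z0 r \<Longrightarrow> \<pi> (j z) = z" and \<omega>: "holomorphic_map R (open_domain UNIV) \<omega>"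
    and \<omega>j: "\<And>z. z \<in> ball z0 r \<Longrightarrow> \<omega> (j z) = w z"
    by (auto simp: regular_continuation_def holomorphic_immersion_def)
  have j: "local_section R \<pi> (ball z0 r) j"
    using jh \<pi>j by (auto simp: local_section_def holomorphic_map_def open_domain_def)
  have \<gamma>': "continuous_map (top_of_set {0..<1}) (mtop R) \<gamma>'" "\<And>t. t \<in> {0..<1} \<Longrightarrow> \<pi> (\<gamma>' t) = \<gamma> t"
    "\<gamma>' 0 = j (\<gamma> 0)"
    using assms(9) by (auto simp: lifted_arc_def)
  have \<gamma>: "continuous_on {0..<1} \<gamma>" using assms(5) by (rule continuous_on_subset) auto
  obtain \<epsilon> h where h: "\<forall>t\<in>{0..<1}. \<epsilon> t > 0" "\<forall>t\<in>{0..<1}. h t holomorphic_on ball (\<gamma> t) (\<epsilon> t)"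
    "\<forall>t\<in>{0..<1}. h t (\<gamma> t) = \<omega> (\<gamma>' t)"
    "\<forall>t\<in>{0..<1}. \<exists>\<delta>>0. \<forall>s\<in>{0..<1}. dist s t < \<delta> \<longrightarrow>
        \<gamma> s \<in> ball (\<gamma> t) (\<epsilon> t) \<and> (\<forall>\<^sub>F z in nhds (\<gamma> s). h s z = h t z)"
    "\<forall>t\<in>{0..<1}. \<forall>U j. local_section R \<pi> U j \<and> \<gamma> t \<in> U \<and> j (\<gamma> t) = \<gamma>' t \<longrightarrow>
        (\<forall>\<^sub>F z in nhds (\<gamma> t). h t z = \<omega> (j z))"
    using continuation_germs_along_path[OF R \<omega> \<gamma>'(1,2) \<gamma>] by blast
  interpret rhs_family g "rhs_germ \<Delta> p F {x. g x = 0}" by (rule fam)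
  \<comment> \<open>The lifted arc starts at \<open>j (\<gamma> 0)\<close> and \<open>j\<close> is a
    section of \<open>\<pi>\<close>, so \<open>j\<close> determines the germ
    \<open>h 0\<close>.\<close>
  have "\<forall>\<^sub>F z in nhds (\<gamma> 0). h 0 z = \<omega> (j z)"
    using h(5)[rule_format, of 0 "ball z0 r" j] j \<gamma>'(3) assms(6) r by simp
  moreover have z0: "\<forall>\<^sub>F z in nhds (\<gamma> 0). z \<in> ball z0 r"
    using assms(6) r by (intro eventually_nhds_in_open) auto
  ultimately have "\<forall>\<^sub>F z in nhds (\<gamma> 0). w z = h 0 z"
    by eventually_elim (simp add: \<omega>j)
  \<comment> \<open>Equality near \<open>\<gamma> 0\<close> is restated as equality of germs at
    every nearby point, the form that \<open>solves_cong\<close> takes.\<close>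
  then have "\<forall>\<^sub>F z in nhds (\<gamma> 0). \<forall>\<^sub>F y in nhds z. w y = h 0 y"
    by (simp add: eventually_eventually)
  then have init: "\<forall>\<^sub>F z in nhds (\<gamma> 0). g (z, h 0 z) \<noteq> 0 \<longrightarrow> solves (h 0) z"
    using z0
  proof eventually_elim
    case (elim z)
    then show ?case
      using initial_solution_solves[OF fam \<eta> assms(2) elim(2)] solves_cong[OF _ elim(1)]
        eventually_nhds_x_imp_x[OF elim(1)] by auto
  qed
  have "continuous_map (mtop R) euclidean \<omega>"
    using \<omega> by (simp add: holomorphic_map_def open_domain_def)
  from continuous_map_compose[OF \<gamma>'(1) this]
  have cont: "continuous_on {0..<1} (\<omega> \<circ> \<gamma>')" by simp
  interpret rhs_family_path g "rhs_germ \<Delta> p F {x. g x = 0}" \<gamma> \<epsilon> h "\<omega> \<circ> \<gamma>'"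
  proof
    fix t :: real assume t: "t \<in> {0..<1}"
    show "\<epsilon> t > 0" "h t holomorphic_on ball (\<gamma> t) (\<epsilon> t)"
      "\<exists>\<delta>>0. \<forall>s\<in>{0..<1}. dist s t < \<delta> \<longrightarrow>
        \<gamma> s \<in> ball (\<gamma> t) (\<epsilon> t) \<and> (\<forall>\<^sub>F z in nhds (\<gamma> s). h s z = h t z)"
      using bspec[OF h(1) t] bspec[OF h(2) t] bspec[OF h(4) t] .
    show "h t (\<gamma> t) = (\<omega> \<circ> \<gamma>') t" using bspec[OF h(3) t] by simp
  next
    show "\<exists>v. g (\<gamma> 1, v) \<noteq> 0" using assms(7) by (auto simp: \<S>)
  qed (rule assms(5) cont init)+
  show ?thesis by (rule limit_exists)
qed

end
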